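(* Let $\theta$ be a primitive substitution on $\{0,1\}^*$ such that $\theta(0)$ begins with $0$ and $\theta(1)$ begins with $1$, and such that the matrix $M_\theta$ has rational eigenvalues. Then the frequencies of letters on the diagonal of the 2D self-similar tiling generated by the direct product substitution $\theta\times\theta$ exist.
   Context: A substitution $\theta$ on $\{0,1\}$ is a monoid morphism of $\{0,1\}^*$ sending each letter to a nonempty word. Its matrix $M_\theta$ is the $2\times 2$ matrix whose entry $M_\theta(i,j)$ is the number of occurrences of the letter $j$ in $\theta(i)$; $\theta$ is primitive if some power of $M_\theta$ has all entries positive. Let $\lambda$ be the Perron-Frobenius eigenvalue of $M_\theta$ and $w=(w_0,w_1)^T$ a right Perron-Frobenius eigenvector, $M_\theta w=\lambda w$, $w_0,w_1>0$ (unique up to scaling; the scaling is irrelevant). Let $u^*=\theta^\infty(0)$ and $v^*=\theta^\infty(1)$ be the fixed points of $\theta$ beginning with $0$ and $1$. The direct product substitution is $(\theta\times\theta)(i,j)=\theta(i)\times\theta(j)$, where for words $x,y$ of lengths $m,n$, $x\times y$ is the array $\big((x_k,y_\ell)\big)_{1\le k\le m,\,1\le \ell\le n}$. Its fixed points are the infinite arrays $x\times y=\big((x_k,y_\ell)\big)_{k,\ell\ge1}$ with $x,y\in\{u^*,v^*\}$. The 1D self-similar tiling of $[0,\infty)$ associated with $x=x_1x_2\dots$ is obtained by placing consecutively, starting at $0$, intervals of lengths $w_{x_1},w_{x_2},\dots$. The 2D self-similar tiling of the quadrant $[0,\infty)^2$ associated with $x\times y$ is obtained by taking the product of the 1D tiling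 of $x$ (horizontally) and the 1D tiling of $y$ (vertically); the tile with label $(i,j)$ is a $w_i\times w_j$ rectangle (width $w_i$, height $w_j$). The diagonal of the 2D tiling is the sequence of tiles whose interior is met by the line $\{(t,t):t>0\}$, in order of increasing $t$. The letters on the diagonal are the types of these tiles, the type of a tile consisting of its label $(i,j)$ together with the way in which the diagonal line intersects the tile (i.e. the position of the line relative to the tile, up to translation of the tile to a standard position). For example, for $\theta(0)=010$, $\theta(1)=11010$, $w=(1,2)^T$, there are eight letters for the tiling of $u^*\times v^*$: a $1\times 2$ tile, for instance, gives two letters according to whether the diagonal crosses its lower or its upper unit square. The frequency of a letter $a$ on the diagonal $d_1d_2d_3\dots$ is $\lim_{n\to\infty}\frac1n\mathrm{Card}\{1\le k\le n: d_k=a\}$, when this limit exists. *)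

theory Defs
  imports Complex_Main "Jordan_Normal_Form.Spectral_Radius"
begin

text \<open>
  Letters are the naturals \<open>0\<close> and \<open>1\<close>; finite words are lists, and infinite words are functions
  on \<open>nat\<close>. All words, arrays and sequences are indexed from \<open>0\<close>. A substitution is given by its
  values on letters, and its values on letters other than \<open>0\<close> and \<open>1\<close> play no role.
\<close>

definition is_substitution :: "(nat \<Rightarrow> nat list) \<Rightarrow> bool" where
  "is_substitution \<theta> \<longleftrightarrow> (\<forall>i\<in>{0, 1}. \<theta> i \<noteq> [] \<and> set (\<theta> i) \<subseteq> {0, 1})"

definition subst_word :: "(nat \<Rightarrow> nat list) \<Rightarrow> nat list \<Rightarrow> nat list" where
  "subst_word \<theta> xs = concat (map \<theta> xs)"

definition subst_matrix :: "(nat \<Rightarrow> nat list) \<Rightarrow> nat mat" where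
  "subst_matrix \<theta> = mat 2 2 (\<lambda>(i, j). count_list (\<theta> i) j)"

definition primitive_substitution :: "(nat \<Rightarrow> nat list) \<Rightarrow> bool" where
  "primitive_substitution \<theta> \<longleftrightarrow>
     (\<exists>n. \<forall>i<2. \<forall>j<2. (subst_matrix \<theta> ^\<^sub>m n) $$ (i, j) > 0)"

definition rational_eigenvalues :: "(nat \<Rightarrow> nat list) \<Rightarrow> bool" where
  "rational_eigenvalues \<theta> \<longleftrightarrow>
     (\<forall>\<mu>. eigenvalue (map_mat of_nat (subst_matrix \<theta>) :: complex mat) \<mu> \<longrightarrow> \<mu> \<in> \<rat>)"

text \<open>For a primitive matrix the Perron-Frobenius eigenvalue is the spectral radius.\<close>

definition pf_eigenvalue :: "(nat \<Rightarrow> nat list) \<Rightarrow> real" where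
  "pf_eigenvalue \<theta> = spectral_radius (map_mat of_nat (subst_matrix \<theta>))"

definition pf_eigenvector :: "(nat \<Rightarrow> nat list) \<Rightarrow> real vec \<Rightarrow> bool" where
  "pf_eigenvector \<theta> w \<longleftrightarrow>
     eigenvector (map_mat real (subst_matrix \<theta>)) w (pf_eigenvalue \<theta>) \<and> w $ 0 > 0 \<and> w $ 1 > 0"

text \<open>
  The infinite word \<open>\<theta>\<^sup>\<infinity>(a)\<close>. Letter \<open>k\<close> is read off the first iterate that is long enough; the
  choice of the iterate is irrelevant when \<open>\<theta>(a)\<close> begins with \<open>a\<close>
  (lemma \<open>limit_word_eq\<close> below).
\<close>

definition limit_word :: "(nat \<Rightarrow> nat list) \<Rightarrow> nat \<Rightarrow> nat \<Rightarrow> nat" where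
  "limit_word \<theta> a k =
     ((subst_word \<theta> ^^ (LEAST n. k < length ((subst_word \<theta> ^^ n) [a]))) [a]) ! k"

text \<open>
  Finite two-dimensional arrays are lists of columns: entry \<open>(k, l)\<close> of \<open>B\<close> is \<open>B ! k ! l\<close>, where
  \<open>k\<close> is the horizontal and \<open>l\<close> the vertical coordinate. An infinite array \<open>X\<close> is fixed by a
  substitution \<open>S\<close> of letters by arrays if the arrays \<open>S (X k l)\<close> fit together, in the positions
  given by the cuts \<open>p\<close> and \<open>q\<close>, to form \<open>X\<close>.
\<close>

definition word_product :: "'a list \<Rightarrow> 'b list \<Rightarrow> ('a \<times> 'b) list list" where
  "word_product xs ys = map (\<lambda>a. map (\<lambda>b. (a, b)) ys) xs"

definition direct_product_subst :: "(nat \<Rightarrow> nat list) \<Rightarrow> nat \<times> nat \<Rightarrow> (nat \<times> nat) list list" where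
  "direct_product_subst \<theta> = (\<lambda>(i, j). word_product (\<theta> i) (\<theta> j))"

definition array_product :: "(nat \<Rightarrow> 'a) \<Rightarrow> (nat \<Rightarrow> 'b) \<Rightarrow> nat \<Rightarrow> nat \<Rightarrow> 'a \<times> 'b" where
  "array_product x y k l = (x k, y l)"

definition fixed_array :: "('a \<Rightarrow> 'a list list) \<Rightarrow> (nat \<Rightarrow> nat \<Rightarrow> 'a) \<Rightarrow> bool" where
  "fixed_array S X \<longleftrightarrow>
     (\<exists>p q. p 0 = 0 \<and> q 0 = 0 \<and>
        (\<forall>k l. p (Suc k) = p k + length (S (X k l)) \<and>
           (\<forall>s < length (S (X k l)). q (Suc l) = q l + length (S (X k l) ! s) \<and>
              (\<forall>t < length (S (X k l) ! s). X (p k + s) (q l + t) = S (X k l) ! s ! t))))"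

text \<open>Tile \<open>m\<close> of the tiling of the half-line is \<open>[boundary w x m, boundary w x (Suc m)]\<close>.\<close>

definition boundary :: "real vec \<Rightarrow> (nat \<Rightarrow> nat) \<Rightarrow> nat \<Rightarrow> real" where
  "boundary w x m = (\<Sum>k<m. w $ x k)"

definition tile_interior ::
  "real vec \<Rightarrow> (nat \<Rightarrow> nat) \<Rightarrow> (nat \<Rightarrow> nat) \<Rightarrow> nat \<times> nat \<Rightarrow> (real \<times> real) set" where
  "tile_interior w x y = (\<lambda>(m, n).
     {boundary w x m <..< boundary w x (Suc m)} \<times> {boundary w y n <..< boundary w y (Suc n)})"

definition diagonal_line :: "(real \<times> real) set" where
  "diagonal_line = {(t, t) | t. t > 0}"

definition diagonal_tiles :: "real vec \<Rightarrow> (nat \<Rightarrow> nat) \<Rightarrow> (nat \<Rightarrow> nat) \<Rightarrow> (nat \<times> nat) set" where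
  "diagonal_tiles w x y = {p. tile_interior w x y p \<inter> diagonal_line \<noteq> {}}"

text \<open>
  The enumeration of the diagonal tiles in order of increasing \<open>t\<close>. It exists and is unique because
  the diagonal meets the interiors of distinct tiles in disjoint open segments, infinitely many in
  all but only finitely many below any given height.
\<close>

definition diagonal_enum :: "real vec \<Rightarrow> (nat \<Rightarrow> nat) \<Rightarrow> (nat \<Rightarrow> nat) \<Rightarrow> nat \<Rightarrow> nat \<times> nat" where
  "diagonal_enum w x y = (THE d.
     range d = diagonal_tiles w x y \<and>
     (\<forall>k l s t. k < l \<and> (s, s) \<in> tile_interior w x y (d k) \<and> (t, t) \<in> tile_interior w x y (d l)
        \<longrightarrow> s < t))"

text \<open>
  The type of a tile: its label together with the trace of the diagonal line on the tile, translated
  so that the lower left corner of the tile becomes the origin.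
\<close>

type_synonym diagonal_letter = "(nat \<times> nat) \<times> (real \<times> real) set"

definition tile_type ::
  "real vec \<Rightarrow> (nat \<Rightarrow> nat) \<Rightarrow> (nat \<Rightarrow> nat) \<Rightarrow> nat \<times> nat \<Rightarrow> diagonal_letter" where
  "tile_type w x y = (\<lambda>(m, n).
     (array_product x y m n,
      (\<lambda>(s, t). (s - boundary w x m, t - boundary w y n)) `
        (tile_interior w x y (m, n) \<inter> diagonal_line)))"

definition diagonal_word ::
  "real vec \<Rightarrow> (nat \<Rightarrow> nat) \<Rightarrow> (nat \<Rightarrow> nat) \<Rightarrow> nat \<Rightarrow> diagonal_letter" where
  "diagonal_word w x y k = tile_type w x y (diagonal_enum w x y k)"

definition frequency_exists :: "(nat \<Rightarrow> 'a) \<Rightarrow> 'a \<Rightarrow> bool" where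
  "frequency_exists d a \<longleftrightarrow> convergent (\<lambda>n. real (card {k. k < n \<and> d k = a}) / real n)"


lemma subst_word_prefix:
  assumes "\<exists>zs. subst_word \<theta> [a] = a # zs"
  shows "\<exists>zs. (subst_word \<theta> ^^ (n + m)) [a] = (subst_word \<theta> ^^ n) [a] @ zs"
proof -
  have app: "\<exists>zs. (subst_word \<theta> ^^ n) (xs @ ys) = (subst_word \<theta> ^^ n) xs @ zs" for n xs ys
    by (induction n arbitrary: xs ys) (auto simp: subst_word_def funpow_Suc_right simp del: funpow.simps(2))
  have step: "\<exists>zs. (subst_word \<theta> ^^ Suc n) [a] = (subst_word \<theta> ^^ n) [a] @ zs" for n
    using assms app[of n "[a]"] by (auto simp: funpow_Suc_right simp del: funpow.simps(2))
  show ?thesis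
  proof (induction m)
    case (Suc m)
    then show ?case using step[of "n + m"] by (metis add_Suc_right append_assoc)
  qed simp
qed

lemma limit_word_eq:
  assumes pre: "\<exists>zs. subst_word \<theta> [a] = a # zs"
    and k: "k < length ((subst_word \<theta> ^^ n) [a])"
  shows "limit_word \<theta> a k = (subst_word \<theta> ^^ n) [a] ! k"
proof -
  let ?n = "LEAST n. k < length ((subst_word \<theta> ^^ n) [a])"
  have 1: "k < length ((subst_word \<theta> ^^ ?n) [a])" using k by (rule LeastI)
  have "?n \<le> n" using k by (rule Least_le)
  then have "\<exists>zs. (subst_word \<theta> ^^ n) [a] = (subst_word \<theta> ^^ ?n) [a] @ zs"
    using subst_word_prefix[OF pre, of ?n "n - ?n"] by simp
  with 1 show ?thesis unfolding limit_word_def by (auto simp: nth_append)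
qed

lemma concat_map_nth:
  assumes "k < length ys" "s < length (f (ys ! k))"
  shows "(\<Sum>i<k. length (f (ys ! i))) + s < length (concat (map f ys))"
    and "concat (map f ys) ! ((\<Sum>i<k. length (f (ys ! i))) + s) = f (ys ! k) ! s"
  using assms
proof (induction ys arbitrary: k)
  case (Cons y ys)
  { case 1 then show ?case using Cons.IH(1)[of "k - 1"]
      by (cases k) (auto simp: sum.lessThan_Suc_shift simp del: sum.lessThan_Suc) }
  { case 2 then show ?case using Cons.IH(2)[of "k - 1"]
      by (cases k) (auto simp: sum.lessThan_Suc_shift nth_append add.assoc simp del: sum.lessThan_Suc) }
qed auto

lemma word_grows:
  assumes sub: "is_substitution \<theta>" and prim: "primitive_substitution \<theta>"
    and a: "a \<in> {0, 1}" and hd: "hd (\<theta> a) = a"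
  shows "k < length ((subst_word \<theta> ^^ k) [a])"
    and "\<exists>zs. subst_word \<theta> [a] = a # zs"
proof -
  let ?M = "subst_matrix \<theta>"
  have ne: "\<theta> a \<noteq> []" using sub a by (auto simp: is_substitution_def)
  then show pre: "\<exists>zs. subst_word \<theta> [a] = a # zs"
    using hd by (cases "\<theta> a") (auto simp: subst_word_def)
  have M: "?M \<in> carrier_mat 2 2" by (simp add: subst_matrix_def)
  have ne1: "\<theta> a \<noteq> [a]"
  proof
    assume single: "\<theta> a = [a]"
    have row: "?M $$ (a, j) = (if j = a then 1 else 0)" if "j < 2" for j
      using that a single by (auto simp: subst_matrix_def)
    have "(?M ^\<^sub>m n) $$ (a, 1 - a) = 0 \<and> (?M ^\<^sub>m n) $$ (a, a) = 1" for n
    proof (induction n)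
      case 0 then show ?case using a M by auto
    next
      case (Suc n)
      have "?M ^\<^sub>m n \<in> carrier_mat 2 2" using M by simp
      then have "(?M ^\<^sub>m Suc n) $$ (a, j) =
          (\<Sum>i<2. (?M ^\<^sub>m n) $$ (a, i) * ?M $$ (i, j))" if "j < 2" for j
        using M that a by (auto simp: scalar_prod_def lessThan_atLeast0)
      then show ?case using Suc row a by (auto simp: numeral_2_eq_2)
    qed
    then show False using prim a unfolding primitive_substitution_def
      by (metis diff_le_self empty_iff insert_iff less_irrefl less_numeral_extra(1)
          one_less_numeral_iff order_le_less_trans pos2 semiring_norm(76))
  qed
  have set: "set ((subst_word \<theta> ^^ n) [a]) \<subseteq> {0, 1}" for n
  proof (induction n)
    case 0 then show ?case using a by auto
  next
    case (Suc n)
    then show ?case using sub by (fastforce simp: subst_word_def is_substitution_def)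
  qed
  have len: "length xs \<le> length (subst_word \<theta> xs)" if "set xs \<subseteq> {0, 1}" for xs
    using that
  proof (induction xs)
    case (Cons x xs)
    then have "\<theta> x \<noteq> []" using sub by (auto simp: is_substitution_def)
    then have "length (\<theta> x) \<ge> 1" by (cases "\<theta> x") auto
    then show ?case using Cons by (auto simp: subst_word_def)
  qed (simp add: subst_word_def)
  have len2: "length (\<theta> a) \<ge> 2" using pre ne1
    by (cases "\<theta> a" rule: remdups_adj.cases) (auto simp: subst_word_def)
  show "k < length ((subst_word \<theta> ^^ k) [a])"
  proof (induction k)
    case (Suc k)
    obtain zs where zs: "(subst_word \<theta> ^^ k) [a] = a # zs"
      using subst_word_prefix[OF pre, of 0 k] by auto
    have "length (subst_word \<theta> (a # zs)) = length (\<theta> a) + length (subst_word \<theta> zs)"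
      by (simp add: subst_word_def)
    moreover have "length zs \<le> length (subst_word \<theta> zs)"
      using set[of k] zs by (intro len) auto
    ultimately show ?case using Suc zs len2 by simp
  qed simp
qed

lemma limit_word_fixed:
  assumes "is_substitution \<theta>" "primitive_substitution \<theta>" "a \<in> {0, 1}" "hd (\<theta> a) = a"
    and s: "s < length (\<theta> (limit_word \<theta> a k))"
  shows "limit_word \<theta> a ((\<Sum>i<k. length (\<theta> (limit_word \<theta> a i))) + s)
           = \<theta> (limit_word \<theta> a k) ! s"
proof -
  note gr = word_grows[OF assms(1-4)]
  let ?W = "(subst_word \<theta> ^^ k) [a]"
  have eq: "limit_word \<theta> a i = ?W ! i" if "i \<le> k" for i
    using that gr by (intro limit_word_eq) (auto intro: le_less_trans)
  have sm: "(\<Sum>i<k. length (\<theta> (limit_word \<theta> a i))) = (\<Sum>i<k. length (\<theta> (?W ! i)))"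
    by (intro sum.cong) (auto simp: eq)
  have s': "s < length (\<theta> (?W ! k))" using s eq by simp
  have suc: "(subst_word \<theta> ^^ Suc k) [a] = concat (map \<theta> ?W)"
    by (simp add: subst_word_def)
  show ?thesis
    using concat_map_nth[where f = \<theta> and ys = ?W and k = k and s = s, OF gr(1) s']
    by (simp only: sm eq suc[symmetric] order_refl limit_word_eq[OF gr(2)])
qed

theorem limit_words_fixed_array:
  assumes "is_substitution \<theta>" "primitive_substitution \<theta>" "hd (\<theta> 0) = 0" "hd (\<theta> 1) = 1"
    and "x \<in> {limit_word \<theta> 0, limit_word \<theta> 1}" and "y \<in> {limit_word \<theta> 0, limit_word \<theta> 1}"
  shows "fixed_array (direct_product_subst \<theta>) (array_product x y)"
proof -
  have "z ((\<Sum>i<k. length (\<theta> (z i))) + s) = \<theta> (z k) ! s"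
    if "z \<in> {limit_word \<theta> 0, limit_word \<theta> 1}" "s < length (\<theta> (z k))" for z k s
    using that limit_word_fixed[OF assms(1,2)] assms(3,4) by fastforce
  note fx = this[OF assms(5)] and fy = this[OF assms(6)]
  show ?thesis unfolding fixed_array_def
    by (rule exI[of _ "\<lambda>k. \<Sum>i<k. length (\<theta> (x i))"],
        rule exI[of _ "\<lambda>k. \<Sum>i<k. length (\<theta> (y i))"])
      (auto simp: direct_product_subst_def array_product_def word_product_def fx fy)
qed

end

theory Submission
  imports Defs
begin

text \<open>
  Rationality makes the tile lengths commensurable: after scaling, \<open>w\<close> consists of coprime positive
  integers and the eigenvalue \<open>L\<close> is an integer. Cut every tile into unit cells \<open>(i, s)\<close>, where \<open>s\<close>
  is the offset within a tile of type \<open>i\<close>. The cell sequences \<open>X\<close> and \<open>Y\<close> of the two 1D tilings are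
  fixed by one substitution of constant length \<open>L\<close>, and the diagonal is coded by the pair sequence
  \<open>(X n, Y n)\<close>. It remains to see that letters have frequencies in this pair sequence, although the
  pair substitution need not be primitive.

  Two cells meet if they are equal or if both start a tile. If a meeting can be reached from every
  pair, then some pair can be reached from every pair, and the averages over level \<open>K\<close> blocks
  contract to a constant. Otherwise there is a class of pairs trapped away from meetings. A tiling is
  a staircase path on a cylinder, and trapped paths never touch; so their gap, measured
  around the cylinder, is a bounded function \<open>D\<close> of the pair. If within such a class one cell could be
  paired with both tile starts, then the gap between \<open>X\<close> and \<open>Y\<close> would be a difference of
  two values of \<open>D\<close> with equal block averages, yet of constant sign on a trapped block, which is absurd.
  Hence trapped pairs evolve deterministically and the pair sequence is periodic.
\<close>

section \<open>Averages over blocks\<close>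

definition block_avg :: "(nat \<Rightarrow> real) \<Rightarrow> nat \<Rightarrow> nat \<Rightarrow> real" where
  "block_avg f B n = (\<Sum>r<B. f (B * n + r)) / real B"

lemma sum_blocks:
  fixes f :: "nat \<Rightarrow> real"
  shows "(\<Sum>b<m. \<Sum>r<B. f (B * b + r)) = (\<Sum>k<B * m. f k)"
proof -
  have "(\<Sum>r<B. f (B * b + r)) = sum f {b * B..<b * B + B}" for b
    using sum.shift_bounds_nat_ivl[of f 0 "b * B" B]
    by (simp add: atLeast0LessThan algebra_simps)
  then show ?thesis
    using sum.nat_group[of f B m] by (simp add: mult.commute)
qed

lemma block_avg_mult:
  assumes "A > 0" "B > 0"
  shows "block_avg f (A * B) n = (\<Sum>r<A. block_avg f B (A * n + r)) / real A"
proof -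
  have "(\<Sum>k<B * A. f (B * (A * n) + k)) = (\<Sum>r<A. \<Sum>s<B. f (B * (A * n + r) + s))"
    using sum_blocks[where f = "\<lambda>k. f (B * (A * n) + k)" and B = B and m = A]
    by (simp add: algebra_simps)
  then show ?thesis
    using assms by (simp add: block_avg_def sum_divide_distrib[symmetric] mult_ac)
qed

lemma block_avg_bounds:
  assumes "B > 0" "\<And>r. r < B \<Longrightarrow> lo \<le> f (B * n + r) \<and> f (B * n + r) \<le> hi"
  shows "lo \<le> block_avg f B n \<and> block_avg f B n \<le> hi"
proof -
  have "(\<Sum>r<B. lo) \<le> (\<Sum>r<B. f (B * n + r))" "(\<Sum>r<B. f (B * n + r)) \<le> (\<Sum>r<B. hi)"
    by (intro sum_mono; simp add: assms)+
  then show ?thesis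
    using assms(1) by (simp add: block_avg_def field_simps)
qed

text \<open>A prefix consists of whole blocks and fewer than \<open>B\<close> further terms, whose
  share tends to 0. So all late averages lie in an interval hardly longer than
  \<open>hi - lo\<close>, and they form a Cauchy sequence whose limit need not be known.\<close>

lemma average_convergent:
  fixes f :: "nat \<Rightarrow> real"
  assumes f: "\<And>k. 0 \<le> f k \<and> f k \<le> 1"
    and blk: "\<And>e. e > 0 \<Longrightarrow> \<exists>B>0. \<exists>lo hi. hi - lo < e \<and>
      (\<forall>b. lo \<le> block_avg f B b \<and> block_avg f B b \<le> hi)"
  shows "convergent (\<lambda>n. (\<Sum>k<n. f k) / real n)"
proof -
  have "Cauchy (\<lambda>n. (\<Sum>k<n. f k) / real n)"
  proof (rule metric_CauchyI)
    fix e :: real assume e: "e > 0"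
    obtain B lo hi where B: "B > 0" and lh: "hi - lo < e / 3"
      and bd: "\<And>b. lo \<le> block_avg f B b \<and> block_avg f B b \<le> hi"
      using blk[of "e / 3"] e by auto
    have avg01: "0 \<le> block_avg f B 0 \<and> block_avg f B 0 \<le> 1"
      by (rule block_avg_bounds[OF B]) (simp add: f)
    have lo1: "lo \<le> 1" and hi0: "0 \<le> hi"
      using bd[of 0] avg01 by linarith+
    have S: "lo * n - B \<le> (\<Sum>k<n. f k) \<and> (\<Sum>k<n. f k) \<le> hi * n + B" for n :: nat
    proof -
      define m t where "m = n div B" and "t = n mod B"
      have n: "n = B * m + t" and t: "t < B" using B by (auto simp: m_def t_def)
      have split: "(\<Sum>k<n. f k) = (\<Sum>k<B * m. f k) + (\<Sum>k\<in>{B * m..<n}. f k)"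
        using n by (metis le_add1 sum.atLeastLessThan_concat atLeast0LessThan zero_le)
      have rest: "0 \<le> (\<Sum>k\<in>{B * m..<n}. f k)" "(\<Sum>k\<in>{B * m..<n}. f k) \<le> t"
        using sum_nonneg[of "{B * m..<n}" f] sum_mono[of "{B * m..<n}" f "\<lambda>_. 1"] f n by auto
      have main: "(\<Sum>k<B * m. f k) = (\<Sum>b<m. B * block_avg f B b)"
        using B by (simp add: sum_blocks[symmetric] block_avg_def)
      have "(\<Sum>b<m. B * lo) \<le> (\<Sum>b<m. B * block_avg f B b)"
           "(\<Sum>b<m. B * block_avg f B b) \<le> (\<Sum>b<m. B * hi)"
        using B bd by (intro sum_mono mult_left_mono; simp)+
      then have "lo * (B * m) \<le> (\<Sum>k<B * m. f k)" "(\<Sum>k<B * m. f k) \<le> hi * (B * m)"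
        by (simp_all add: main algebra_simps)
      moreover have "lo * t \<le> 1 * real t"
        using lo1 by (intro mult_right_mono) simp_all
      moreover have "0 \<le> hi * real t" using hi0 by simp
      moreover have "real t \<le> B" using t by simp
      moreover have "lo * n = lo * (B * m) + lo * t" "hi * n = hi * (B * m) + hi * t"
        by (simp_all add: n algebra_simps)
      ultimately show ?thesis using split rest by linarith
    qed
    obtain N :: nat where N: "real N > 3 * B / e" using reals_Archimedean2 by blast
    moreover have "3 * B / e > 0" using B e by simp
    ultimately have N0: "N > 0" by (metis of_nat_0_less_iff order_less_trans)
    have close: "lo - e / 3 < (\<Sum>k<n. f k) / n \<and> (\<Sum>k<n. f k) / n < hi + e / 3" if "n \<ge> N" for n
    proof -
      have n0: "real n > 0" using that N0 by simp
      have "3 * B / e < n" using N that by linarith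
      then have "B < e / 3 * n" using e by (simp add: field_simps)
      with S[of n] have "(lo - e / 3) * n < (\<Sum>k<n. f k)" "(\<Sum>k<n. f k) < (hi + e / 3) * n"
        by (simp_all add: algebra_simps)
      then show ?thesis using n0 by (simp add: field_simps)
    qed
    show "\<exists>M. \<forall>m\<ge>M. \<forall>n\<ge>M. dist ((\<Sum>k<m. f k) / real m) ((\<Sum>k<n. f k) / real n) < e"
    proof (intro exI allI impI)
      fix m n assume "m \<ge> N" "n \<ge> N"
      then show "dist ((\<Sum>k<m. f k) / real m) ((\<Sum>k<n. f k) / real n) < e"
        using close[of m] close[of n] lh by (simp add: dist_real_def abs_less_iff)
    qed
  qed
  then show ?thesis by (rule Cauchy_convergent)
qed

text \<open>Each block of level \<open>Suc j\<close> indexed in \<open>S\<close> contains one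
  sub-block with the average \<open>v\<close>, the same for all of them. Only the other
  \<open>Q - 1\<close> can differ, so the spread of the averages shrinks by the factor
  \<open>1 - 1 / Q\<close>.\<close>

lemma block_avg_contraction:
  fixes f :: "nat \<Rightarrow> real"
  assumes Q: "Q > 0" and closed: "\<And>n r. S n \<Longrightarrow> r < Q \<Longrightarrow> S (Q * n + r)"
    and common: "\<And>j. \<exists>v. \<forall>n. S n \<longrightarrow> (\<exists>r<Q. block_avg f (Q ^ j) (Q * n + r) = v)"
    and f: "\<And>n. S n \<Longrightarrow> 0 \<le> f n \<and> f n \<le> M"
  shows "\<exists>lo hi. (\<forall>n. S n \<longrightarrow> lo \<le> block_avg f (Q ^ j) n \<and> block_avg f (Q ^ j) n \<le> hi) \<and>
    hi - lo \<le> (1 - 1 / real Q) ^ j * M"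
proof (induction j)
  case 0
  show ?case
    by (rule exI[of _ 0], rule exI[of _ M]) (auto simp: block_avg_def f)
next
  case (Suc j)
  then obtain lo hi where IH: "\<And>n. S n \<Longrightarrow> lo \<le> block_avg f (Q ^ j) n \<and> block_avg f (Q ^ j) n \<le> hi"
    and lh: "hi - lo \<le> (1 - 1 / real Q) ^ j * M" by auto
  obtain v where v: "\<And>n. S n \<Longrightarrow> \<exists>r<Q. block_avg f (Q ^ j) (Q * n + r) = v"
    using common[of j] by auto
  define lo' hi' where "lo' = (v + (real Q - 1) * lo) / Q" and "hi' = (v + (real Q - 1) * hi) / Q"
  have "lo' \<le> block_avg f (Q ^ Suc j) n \<and> block_avg f (Q ^ Suc j) n \<le> hi'" if n: "S n" for n
  proof -
    obtain r where r: "r < Q" "block_avg f (Q ^ j) (Q * n + r) = v" using v[OF n] by auto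
    define g where "g = (\<lambda>s. block_avg f (Q ^ j) (Q * n + s))"
    have "sum g {..<Q} = g r + sum g ({..<Q} - {r})"
      using r by (simp add: sum.remove)
    moreover have "(\<Sum>s\<in>{..<Q} - {r}. lo) \<le> sum g ({..<Q} - {r})"
        "sum g ({..<Q} - {r}) \<le> (\<Sum>s\<in>{..<Q} - {r}. hi)"
      using IH closed[OF n] by (intro sum_mono; simp add: g_def)+
    moreover have "real (card ({..<Q} - {r})) = real Q - 1" using r Q by (simp add: of_nat_diff)
    ultimately have "v + (real Q - 1) * lo \<le> sum g {..<Q}" "sum g {..<Q} \<le> v + (real Q - 1) * hi"
      using r by (simp_all add: g_def)
    moreover have "block_avg f (Q ^ Suc j) n = sum g {..<Q} / Q"
      using block_avg_mult[of Q "Q ^ j" f n] Q by (simp add: g_def)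
    ultimately show ?thesis using Q by (simp add: lo'_def hi'_def divide_right_mono)
  qed
  moreover have "hi' - lo' = (1 - 1 / real Q) * (hi - lo)"
    using Q by (simp add: lo'_def hi'_def field_simps)
  moreover have "(1 - 1 / real Q) * (hi - lo) \<le> (1 - 1 / real Q) * ((1 - 1 / real Q) ^ j * M)"
    using lh Q by (intro mult_left_mono) (auto simp: field_simps)
  ultimately show ?case by (intro exI[of _ lo'] exI[of _ hi']) auto
qed

lemma contraction_small:
  fixes M e :: real
  assumes "Q > 0" "e > 0"
  shows "\<exists>j. (1 - 1 / real Q) ^ j * M < e"
proof -
  have "\<bar>1 - 1 / real Q\<bar> < 1" using assms by (auto simp: field_simps)
  then have "(\<lambda>j. (1 - 1 / real Q) ^ j * M) \<longlonglongrightarrow> 0 * M"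
    by (intro tendsto_intros LIMSEQ_power_zero) simp
  from order_tendstoD(2)[OF this, of e] assms(2) show ?thesis
    by (auto simp: eventually_sequentially)
qed

lemma periodic_average_convergent:
  fixes f :: "nat \<Rightarrow> real"
  assumes f: "\<And>k. 0 \<le> f k \<and> f k \<le> 1" and P: "P > 0" "\<And>k. f (k + P) = f k"
  shows "convergent (\<lambda>n. (\<Sum>k<n. f k) / real n)"
proof (rule average_convergent[OF f])
  fix e :: real assume e: "e > 0"
  have "f (P * b + r) = f r" for b r
  proof (induction b)
    case (Suc b)
    then show ?case using P(2)[of "P * b + r"] by (simp add: algebra_simps)
  qed simp
  then have "block_avg f P b = block_avg f P 0" for b by (simp add: block_avg_def)
  then have "\<forall>b. block_avg f P 0 \<le> block_avg f P b \<and> block_avg f P b \<le> block_avg f P 0"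
    by (metis order_refl)
  then show "\<exists>B>0. \<exists>lo hi. hi - lo < e \<and> (\<forall>b. lo \<le> block_avg f B b \<and> block_avg f B b \<le> hi)"
    using P(1) e by (intro exI[of _ P] exI[of _ "block_avg f P 0"] conjI) simp_all
qed

section \<open>Cell sequences fixed by a substitution of constant length\<close>

text \<open>Equal transverse positions of two staircase paths amount to this, see lemma
  \<open>phase\<close>: where a tile starts, the position does not reveal its type.\<close>

definition meeting :: "nat \<times> nat \<Rightarrow> nat \<times> nat \<Rightarrow> bool" where
  "meeting c d \<longleftrightarrow> c = d \<or> snd c = 0 \<and> snd d = 0"

text \<open>\<open>\<sigma> r c\<close> is the \<open>r\<close>-th cell in the image of the cell
  \<open>c\<close>. \<open>\<sigma>_start\<close> reflects that the image of a letter begins with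
  this letter, and \<open>\<sigma>_occurs\<close> that it contains both letters.\<close>

locale cell_substitution =
  fixes w :: "nat \<Rightarrow> nat" and L :: nat and \<sigma> :: "nat \<Rightarrow> nat \<times> nat \<Rightarrow> nat \<times> nat"
  assumes w_pos: "w 0 > 0" "w 1 > 0" and w_coprime: "coprime (w 0) (w 1)" and L: "L \<ge> 2"
    and \<sigma>_start: "\<And>i. i \<in> {0, 1} \<Longrightarrow> \<sigma> 0 (i, 0) = (i, 0)"
    and \<sigma>_occurs: "\<And>i j. i \<in> {0, 1} \<Longrightarrow> j \<in> {0, 1} \<Longrightarrow> \<exists>s<w j. \<exists>r<L. \<sigma> r (j, s) = (i, 0)"
begin

definition cells :: "(nat \<times> nat) set" where
  "cells = {(i, s). i \<in> {0, 1} \<and> s < w i}"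

text \<open>At the end of a tile the last clause fixes only the offset 0 of the next cell: the type
  there refers back to \<open>X (Suc n)\<close>, so it is left free.\<close>

definition fixed_cells :: "(nat \<Rightarrow> nat \<times> nat) \<Rightarrow> bool" where
  "fixed_cells X \<longleftrightarrow> (\<forall>n. X n \<in> cells) \<and> snd (X 0) = 0 \<and>
     (\<forall>n. \<forall>r<L. X (L * n + r) = \<sigma> r (X n)) \<and>
     (\<forall>n. X (Suc n) = (if Suc (snd (X n)) < w (fst (X n)) then (fst (X n), Suc (snd (X n)))
                     else (fst (X (Suc n)), 0)))"

lemma finite_cells: "finite cells"
proof -
  have "cells = (\<Union>i\<in>{0, 1}. (\<lambda>s. (i, s)) ` {..<w i})" by (auto simp: cells_def)
  then show ?thesis by simp
qed

lemma fixed_cellsD: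
  assumes "fixed_cells X"
  shows "X n \<in> cells" "snd (X 0) = 0" "r < L \<Longrightarrow> X (L * n + r) = \<sigma> r (X n)"
    "Suc (snd (X n)) < w (fst (X n)) \<Longrightarrow> X (Suc n) = (fst (X n), Suc (snd (X n)))"
    "\<not> Suc (snd (X n)) < w (fst (X n)) \<Longrightarrow> snd (X (Suc n)) = 0"
proof -
  from assms have step: "X (Suc n) = (if Suc (snd (X n)) < w (fst (X n)) then (fst (X n), Suc (snd (X n)))
                     else (fst (X (Suc n)), 0))" unfolding fixed_cells_def by blast
  show "\<not> Suc (snd (X n)) < w (fst (X n)) \<Longrightarrow> snd (X (Suc n)) = 0"
    by (subst step) simp
  show "Suc (snd (X n)) < w (fst (X n)) \<Longrightarrow> X (Suc n) = (fst (X n), Suc (snd (X n)))"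
    by (subst step) simp
qed (use assms in \<open>unfold fixed_cells_def, blast+\<close>)

lemma fixed_cells_start:
  assumes "fixed_cells X" "snd (X n) = 0"
  obtains i where "i \<in> {0, 1}" "X n = (i, 0)"
  using fixed_cellsD(1)[OF assms(1), of n] assms(2) by (cases "X n") (auto simp: cells_def)

lemma less_power: "n < L ^ n"
  using L by (metis less_exp order_less_le_trans power_mono zero_le_numeral le0)

lemma L_pos: "L ^ K > 0" using L by simp

lemma block_index: "r < L ^ a \<Longrightarrow> s < L ^ b \<Longrightarrow> L ^ b * r + s < L ^ (a + b)"
proof -
  assume "r < L ^ a" "s < L ^ b"
  then have "L ^ b * r + s < L ^ b * Suc r" by simp
  also have "\<dots> \<le> L ^ b * L ^ a" using \<open>r < L ^ a\<close> by (intro mult_le_mono) auto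
  finally show ?thesis by (simp add: power_add mult.commute)
qed

lemma power_index: "L ^ b * (L ^ a * n + r) + s = L ^ (a + b) * n + (L ^ b * r + s)"
  by (simp add: power_add algebra_simps)

text \<open>Both sequences obey the same \<open>\<sigma>\<close>, so one cell determines its whole
  block, whichever sequence it comes from. Hence descents can be copied, also from \<open>X\<close>
  to \<open>Y\<close>.\<close>

lemma transfer:
  assumes X: "fixed_cells X" and Y: "fixed_cells Y" and eq: "X n = Y m"
  shows "r < L ^ K \<Longrightarrow> X (L ^ K * n + r) = Y (L ^ K * m + r)"
proof (induction K arbitrary: r)
  case (Suc K)
  have r: "r div L < L ^ K"
    using Suc.prems by (simp add: less_mult_imp_div_less mult.commute)
  have idx: "L ^ Suc K * k + r = L * (L ^ K * k + r div L) + r mod L" for k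
    by (simp add: algebra_simps)
  have "r mod L < L" using L by simp
  then show ?case
    unfolding idx using Suc.IH[OF r] by (simp add: fixed_cellsD(3)[OF X] fixed_cellsD(3)[OF Y])
qed (use eq in simp)

text \<open>A tile start is the first cell of its own image. So once it is reached, it is reached at
  every higher level.\<close>

lemma start_stays:
  assumes X: "fixed_cells X" and n: "snd (X n) = 0"
  shows "X (L ^ K * n) = X n"
proof (induction K)
  case (Suc K)
  obtain i where i: "i \<in> {0, 1}" "X n = (i, 0)" using fixed_cells_start[OF X n] .
  have "X (L * (L ^ K * n) + 0) = \<sigma> 0 (X (L ^ K * n))"
    by (rule fixed_cellsD(3)[OF X]) (use L in simp)
  then show ?case using Suc i \<sigma>_start by (simp add: mult_ac)
qed simp

lemma tile_run:
  assumes X: "fixed_cells X" and n: "X n = (i, s)"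
  shows "s + t < w i \<Longrightarrow> X (n + t) = (i, s + t)"
proof (induction t)
  case (Suc t)
  then have "X (n + t) = (i, s + t)" by simp
  then show ?case using fixed_cellsD(4)[OF X, of "n + t"] Suc.prems by simp
qed (use n in simp)

lemma next_start:
  assumes X: "fixed_cells X" and n: "X n = (i, s)"
  shows "snd (X (n + (w i - s))) = 0"
proof -
  have s: "s < w i" using fixed_cellsD(1)[OF X, of n] n by (auto simp: cells_def)
  then have "X (n + (w i - s - 1)) = (i, w i - 1)"
    using tile_run[OF X n, of "w i - s - 1"] by simp
  then have "snd (X (Suc (n + (w i - s - 1)))) = 0"
    using fixed_cellsD(5)[OF X, of "n + (w i - s - 1)"] s by simp
  moreover have "Suc (n + (w i - s - 1)) = n + (w i - s)" using s by simp
  ultimately show ?thesis by (simp only:)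
qed

text \<open>A block longer than both tiles contains a tile start; enough levels later this start has
  unfolded into a whole tile, and the images of the cells of any tile contain both tile starts.
  \<open>start_stays\<close> then covers all higher levels.\<close>

lemma reaches_start:
  assumes X: "fixed_cells X" and i: "i \<in> {0, 1}"
  shows "\<exists>K0. \<forall>K\<ge>K0. \<exists>r<L ^ K. X (L ^ K * n + r) = (i, 0)"
proof -
  define W where "W = w 0 + w 1"
  have wW: "w j \<le> W" if "j \<in> {0, 1}" for j using that by (auto simp: W_def)
  have WL: "W < L ^ W" by (rule less_power)
  obtain j s where js: "X (L ^ W * n) = (j, s)" by (cases "X (L ^ W * n)")
  have j: "j \<in> {0, 1}" "s < w j"
    using fixed_cellsD(1)[OF X, of "L ^ W * n"] js by (auto simp: cells_def)
  define m where "m = L ^ W * n + (w j - s)"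
  have "snd (X m) = 0" unfolding m_def by (rule next_start[OF X js])
  then obtain k where k: "k \<in> {0, 1}" "X m = (k, 0)" using fixed_cells_start[OF X] by blast
  have "X (L ^ W * m) = (k, 0)" using start_stays[OF X] k by simp
  moreover obtain t r where tr: "t < w k" "r < L" "\<sigma> r (k, t) = (i, 0)"
    using \<sigma>_occurs[OF i k(1)] by blast
  ultimately have "X (L ^ W * m + t) = (k, t)"
    using tile_run[OF X, of "L ^ W * m" k 0 t] by simp
  then have hit: "X (L * (L ^ W * m + t) + r) = (i, 0)"
    using fixed_cellsD(3)[OF X tr(2)] tr(3) by simp
  \<comment> \<open>\<open>W\<close> levels to see a tile start, \<open>W\<close> to unfold its
    tile, and one to find the start \<open>(i, 0)\<close> in the image.\<close>
  define K0 where "K0 = W + (W + 1)"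
  define r0 where "r0 = L ^ (W + 1) * (w j - s) + (L * t + r)"
  have "L ^ 1 * t + r < L ^ (W + 1)"
    using tr wW[OF k(1)] WL by (intro block_index) auto
  then have r0: "r0 < L ^ K0"
    unfolding r0_def K0_def using wW[OF j(1)] WL by (intro block_index) auto
  have hit0: "X (L ^ K0 * n + r0) = (i, 0)"
    using hit unfolding K0_def r0_def m_def by (simp add: power_add algebra_simps)
  show ?thesis
  proof (rule exI[of _ K0], intro allI impI)
    fix K assume "K \<ge> K0"
    then obtain d where K: "K = K0 + d" using le_Suc_ex by blast
    have "X (L ^ d * (L ^ K0 * n + r0) + 0) = (i, 0)"
      using start_stays[OF X] hit0 by simp
    then have "X (L ^ K * n + (L ^ d * r0 + 0)) = (i, 0)"
      unfolding power_index K .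
    moreover have "L ^ d * r0 + 0 < L ^ K"
      unfolding K by (intro block_index r0 L_pos)
    ultimately show "\<exists>r<L ^ K. X (L ^ K * n + r) = (i, 0)" by blast
  qed
qed

text \<open>Whether a level reaches the target depends only on the current pair, and there are
  finitely many pairs. As the target consists of tile starts, hits persist at higher levels, so one
  level \<open>K0\<close> serves all indices. Every block of that level contains the target, and the
  block averages contract.\<close>

lemma common_state_frequency:
  fixes P :: "(nat \<times> nat) \<Rightarrow> (nat \<times> nat) \<Rightarrow> bool"
  assumes X: "fixed_cells X" and Y: "fixed_cells Y"
    and n0: "snd (X n0) = 0" "snd (Y n0) = 0"
    and reach: "\<And>n. \<exists>K. \<exists>r<L ^ K. X (L ^ K * n + r) = X n0 \<and> Y (L ^ K * n + r) = Y n0"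
  shows "convergent (\<lambda>N. (\<Sum>k<N. of_bool (P (X k) (Y k))) / real N)"
proof -
  define hits where "hits K n \<longleftrightarrow> (\<exists>r<L ^ K. X (L ^ K * n + r) = X n0 \<and> Y (L ^ K * n + r) = Y n0)"
    for K n
  have ev: "\<forall>\<^sub>F K in sequentially. hits K n" for n
  proof -
    obtain K0 r0 where r0: "r0 < L ^ K0" "X (L ^ K0 * n + r0) = X n0" "Y (L ^ K0 * n + r0) = Y n0"
      using reach[of n] by blast
    have "hits K n" if "K \<ge> K0" for K
    proof -
      define d where "d = K - K0"
      have K: "K = K0 + d" using that by (simp add: d_def)
      have "X (L ^ d * (L ^ K0 * n + r0)) = X n0" "Y (L ^ d * (L ^ K0 * n + r0)) = Y n0"
        using start_stays[OF X, of "L ^ K0 * n + r0" d] start_stays[OF Y, of "L ^ K0 * n + r0" d] r0 n0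
        by simp_all
      then show ?thesis
        unfolding hits_def K using block_index[OF r0(1), of 0 d] L_pos
          power_index[of d K0 n r0 0] by (intro exI[of _ "L ^ d * r0"]) simp
    qed
    then show ?thesis by (auto simp: eventually_sequentially)
  qed
  have hits_cong: "hits K n = hits K m" if "X n = X m" "Y n = Y m" for K n m
    unfolding hits_def using transfer[OF X X that(1)] transfer[OF Y Y that(2)] by auto
  have "\<forall>\<^sub>F K in sequentially. \<forall>n. (X n, Y n) = (X m, Y m) \<longrightarrow> hits K n" for m
    by (rule eventually_mono[OF ev[of m]]) (use hits_cong in blast)
  then have "\<forall>z\<in>range (\<lambda>n. (X n, Y n)). \<forall>\<^sub>F K in sequentially. \<forall>n. (X n, Y n) = z \<longrightarrow> hits K n"
    by blast
  moreover have "finite (range (\<lambda>n. (X n, Y n)))"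
    by (rule finite_subset[of _ "cells \<times> cells"])
      (auto simp: finite_cells fixed_cellsD(1)[OF X] fixed_cellsD(1)[OF Y])
  ultimately have "\<forall>\<^sub>F K in sequentially. \<forall>z\<in>range (\<lambda>n. (X n, Y n)). \<forall>n. (X n, Y n) = z \<longrightarrow> hits K n"
    by (rule eventually_ball_finite[rotated])
  then obtain K0 where "\<forall>z\<in>range (\<lambda>n. (X n, Y n)). \<forall>n. (X n, Y n) = z \<longrightarrow> hits K0 n"
    using eventually_happens'[OF sequentially_bot] by blast
  then have K0: "hits K0 n" for n by blast
  define Q where "Q = L ^ K0"
  have Q: "Q > 0" using L_pos by (simp add: Q_def)
  have Qj: "Q ^ j = L ^ (K0 * j)" for j by (simp add: Q_def power_mult)
  define f :: "nat \<Rightarrow> real" where "f k = of_bool (P (X k) (Y k))" for k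
  have f01: "0 \<le> f k \<and> f k \<le> 1" for k by (simp add: f_def)
  have "convergent (\<lambda>N. (\<Sum>k<N. f k) / real N)"
  proof (rule average_convergent[OF f01])
    fix e :: real assume "e > 0"
    then obtain j where j: "(1 - 1 / real Q) ^ j * 1 < e" using contraction_small[OF Q] by blast
    have "\<exists>lo hi. (\<forall>n. True \<longrightarrow> lo \<le> block_avg f (Q ^ j) n \<and> block_avg f (Q ^ j) n \<le> hi) \<and>
        hi - lo \<le> (1 - 1 / real Q) ^ j * 1"
    proof (rule block_avg_contraction[OF Q])
      fix j
      have "block_avg f (Q ^ j) n = block_avg f (Q ^ j) n0" if "X n = X n0" "Y n = Y n0" for n
        unfolding block_avg_def f_def Qj
        using transfer[OF X X that(1)] transfer[OF Y Y that(2)] by simp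
      then show "\<exists>v. \<forall>n. True \<longrightarrow> (\<exists>r<Q. block_avg f (Q ^ j) (Q * n + r) = v)"
        using K0 unfolding hits_def Q_def[symmetric] by metis
    qed (use f01 in auto)
    then show "\<exists>B>0. \<exists>lo hi. hi - lo < e \<and> (\<forall>b. lo \<le> block_avg f B b \<and> block_avg f B b \<le> hi)"
      using j Q by (intro exI[of _ "Q ^ j"]) (auto intro: le_less_trans)
  qed
  then show ?thesis by (simp add: f_def)
qed

text \<open>It suffices to find one pair of tile starts that is reachable from everywhere. If the
  sequences coincide somewhere, it is two starts of type 0; otherwise it is the initial
  pair.\<close>

lemma meeting_frequency:
  fixes P :: "(nat \<times> nat) \<Rightarrow> (nat \<times> nat) \<Rightarrow> bool"
  assumes X: "fixed_cells X" and Y: "fixed_cells Y"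
    and meet: "\<And>n. \<exists>K. \<exists>r<L ^ K. meeting (X (L ^ K * n + r)) (Y (L ^ K * n + r))"
  shows "convergent (\<lambda>N. (\<Sum>k<N. of_bool (P (X k) (Y k))) / real N)"
proof -
  define desc where "desc n m \<longleftrightarrow> (\<exists>K. \<exists>r<L ^ K. m = L ^ K * n + r)" for n m
  have desc_trans: "desc n k" if "desc n m" "desc m k" for n m k
  proof -
    obtain a r b s where "r < L ^ a" "m = L ^ a * n + r" "s < L ^ b" "k = L ^ b * m + s"
      using \<open>desc n m\<close> \<open>desc m k\<close> unfolding desc_def by blast
    then have "k = L ^ (a + b) * n + (L ^ b * r + s) \<and> L ^ b * r + s < L ^ (a + b)"
      by (simp only: power_index block_index)
    then show ?thesis unfolding desc_def by blast
  qed
  have desc0: "desc 0 n" for n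
    unfolding desc_def using less_power[of n] by (intro exI[of _ n]) simp
  have desc_eq: "\<exists>m'. desc m m' \<and> X m' = X n' \<and> Y m' = Y n'"
    if "desc n n'" "X n = X m" "Y n = Y m" for n n' m
    using that(1) transfer[OF X X that(2)] transfer[OF Y Y that(3)] unfolding desc_def by metis
  have desc_swap: "\<exists>m'. desc m m' \<and> Y m' = X n' \<and> X m' = Y n'"
    if "desc n n'" "X n = Y m" "Y n = X m" for n n' m
    using that(1) transfer[OF X Y that(2)] transfer[OF Y X that(3)] unfolding desc_def by metis
  have coincide: "X n' = Y n'" if "desc n n'" "X n = Y n" for n n'
    using that(1) transfer[OF X Y that(2)] unfolding desc_def by auto
  have "\<exists>n'. desc n n' \<and> meeting (X n') (Y n')" for n
    using meet[of n] unfolding desc_def by blast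
  \<comment> \<open>There are only two types of tiles, and the initial cells differ, since equal
    ones would give \<open>X n = Y n\<close>. So two distinct starts are the initial pair, up to
    order.\<close>
  moreover have "X n = X 0 \<and> Y n = Y 0 \<or> X n = Y 0 \<and> Y n = X 0"
    if "meeting (X n) (Y n)" "X n \<noteq> Y n" for n
  proof -
    have s: "snd (X n) = 0" "snd (Y n) = 0" using that by (auto simp: meeting_def)
    have "X 0 \<noteq> Y 0" using coincide[OF desc0] that(2) by blast
    moreover obtain i j k l where "i \<in> {0, 1}" "X n = (i, 0)" "j \<in> {0, 1}" "Y n = (j, 0)"
        "k \<in> {0, 1}" "X 0 = (k, 0)" "l \<in> {0, 1}" "Y 0 = (l, 0)"
      by (metis fixed_cells_start[OF X s(1)] fixed_cells_start[OF Y s(2)]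
        fixed_cells_start[OF X fixed_cellsD(2)[OF X]] fixed_cells_start[OF Y fixed_cellsD(2)[OF Y]])
    ultimately show ?thesis using that(2) by auto
  qed
  ultimately have next_meeting: "\<exists>n'. desc n n' \<and> (X n' = Y n' \<or> X n' = X 0 \<and> Y n' = Y 0 \<or> X n' = Y 0 \<and> Y n' = X 0)"
    for n by blast
  have "\<exists>n0. snd (X n0) = 0 \<and> snd (Y n0) = 0 \<and> (\<forall>n. \<exists>n'. desc n n' \<and> X n' = X n0 \<and> Y n' = Y n0)"
  proof (cases "\<exists>n. X n = Y n")
    case True
    then obtain n1 where n1: "X n1 = Y n1" by blast
    have hit: "\<exists>n'. desc n n' \<and> X n' = (0, 0) \<and> Y n' = (0, 0)" if "X n = Y n" for n
    proof -
      obtain K r where "r < L ^ K" "X (L ^ K * n + r) = (0, 0)"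
        using reaches_start[OF X, of 0 n] by auto
      then show ?thesis using coincide[OF _ that] unfolding desc_def by metis
    qed
    obtain n0 where n0: "X n0 = (0, 0)" "Y n0 = (0, 0)" using hit[OF n1] by blast
    \<comment> \<open>A meeting without coincidence repeats the initial pair or its swap, and from
      either one the descent from \<open>0\<close> to \<open>n1\<close> can be copied, ending in a
      coincidence.\<close>
    have "\<exists>n'. desc n n' \<and> X n' = Y n'" for n
      using next_meeting[of n] desc_eq[OF desc0[of n1]] desc_swap[OF desc0[of n1]] n1 desc_trans
      by metis
    then have "\<forall>n. \<exists>n'. desc n n' \<and> X n' = X n0 \<and> Y n' = Y n0"
      using hit desc_trans n0 by metis
    then show ?thesis using n0 by (intro exI[of _ n0]) simp
  next
    case False
    have "\<exists>n'. desc n n' \<and> X n' = X 0 \<and> Y n' = Y 0" for n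
    proof -
      obtain n' where n': "desc n n'" "X n' = X 0 \<and> Y n' = Y 0 \<or> X n' = Y 0 \<and> Y n' = X 0"
        using next_meeting[of n] False by blast
      then show ?thesis
      proof (cases "X n' = X 0 \<and> Y n' = Y 0")
        case False
        \<comment> \<open>The swapped pair arises by a descent from the initial pair. The same
          descent with the roles of \<open>X\<close> and \<open>Y\<close> exchanged leads from the
          swapped pair back to the initial one.\<close>
        then have sw: "X n' = Y 0" "Y n' = X 0" using n' by auto
        then obtain m where "desc n' m" "Y m = X n'" "X m = Y n'"
          using desc_swap[OF desc0[of n'], of n'] by auto
        then show ?thesis using sw n'(1) desc_trans by metis
      qed auto
    qed
    then show ?thesis
      using fixed_cellsD(2)[OF X] fixed_cellsD(2)[OF Y] by (intro exI[of _ 0]) simp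
  qed
  then obtain n0 where n0: "snd (X n0) = 0" "snd (Y n0) = 0"
    and all: "\<And>n. \<exists>n'. desc n n' \<and> X n' = X n0 \<and> Y n' = Y n0" by blast
  show ?thesis
    by (rule common_state_frequency[OF X Y n0]) (use all in \<open>unfold desc_def, blast\<close>)
qed

end

section \<open>Pairs that never meet\<close>

text \<open>Two of the first \<open>card C + 1\<close> values agree, so by determinism
  \<open>g\<close> is periodic from there on, with a period of at most \<open>card C\<close>. The
  factorial is a multiple of every such period, and hence does not depend on the window.\<close>

lemma deterministic_window:
  fixes g :: "nat \<Rightarrow> 'a"
  assumes C: "finite C" and g: "\<And>t. t < W \<Longrightarrow> g t \<in> C"
    and det: "\<And>s t. Suc s < W \<Longrightarrow> Suc t < W \<Longrightarrow> g s = g t \<Longrightarrow> g (Suc s) = g (Suc t)"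
    and t: "card C \<le> t" "t + fact (card C) < W"
  shows "g (t + fact (card C)) = g t"
proof -
  have "\<not> inj_on g {..card C}"
  proof
    assume "inj_on g {..card C}"
    moreover have "g ` {..card C} \<subseteq> C" using g t by auto
    ultimately have "card {..card C} \<le> card C" using card_inj_on_le C by blast
    then show False by simp
  qed
  then obtain i k where ik: "i < k" "k \<le> card C" "g i = g k"
    unfolding inj_on_def by (metis atMost_iff linorder_neqE_nat)
  have shift: "k + u < W \<Longrightarrow> g (i + u) = g (k + u)" for u
  proof (induction u)
    case (Suc u)
    then show ?case using det[of "i + u" "k + u"] ik by simp
  qed (use ik in simp)
  define d where "d = k - i"
  have d: "s + d < W \<Longrightarrow> g (s + d) = g s" if "i \<le> s" for s
  proof -
    have "i + (s - i) = s" "k + (s - i) = s + d" using that ik by (simp_all add: d_def)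
    then show "s + d < W \<Longrightarrow> g (s + d) = g s" using shift[of "s - i"] by simp
  qed
  have iter: "t + j * d < W \<Longrightarrow> g (t + j * d) = g t" for j
  proof (induction j)
    case (Suc j)
    then show ?case using d[of "t + j * d"] t ik by (simp add: algebra_simps)
  qed simp
  have "d dvd fact (card C)" using ik by (intro dvd_fact) (auto simp: d_def)
  then obtain j where "fact (card C) = j * d" by (metis dvd_def mult.commute)
  then show ?thesis using iter[of j] t by simp
qed

text \<open>Only finitely many powers are possible, so they are eventually periodic, with some
  period \<open>k\<close> from an exponent \<open>i\<close> on. The multiple \<open>i * k\<close> of
  \<open>k\<close> is at least \<open>i\<close>, so doubling it changes nothing.\<close>

lemma idempotent_relpow:
  fixes R :: "('a \<times> 'a) set"
  assumes "finite A" "R \<subseteq> A \<times> A"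
  shows "\<exists>h>0. R ^^ (h + h) = R ^^ h"
proof -
  have "R ^^ K \<subseteq> A \<times> A" if "K > 0" for K
    using that
  proof (induction K rule: nat_induct_non_zero)
    case 1 then show ?case using assms by simp
  next
    case (Suc n) then show ?case using assms by auto
  qed
  then have "range (\<lambda>K. R ^^ Suc K) \<subseteq> Pow (A \<times> A)" by blast
  then have "finite (range (\<lambda>K. R ^^ Suc K))"
    by (rule finite_subset) (simp add: assms(1))
  then have "\<not> inj (\<lambda>K. R ^^ Suc K)"
    using finite_imageD infinite_UNIV_nat by blast
  then obtain i' j' where ij': "i' < j'" "R ^^ Suc i' = R ^^ Suc j'"
    unfolding inj_def by (metis linorder_neqE_nat)
  define i k where "i = Suc i'" and "k = j' - i'"
  have i: "i > 0" and k: "k > 0" and eq: "R ^^ i = R ^^ (i + k)"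
    using ij' by (simp_all add: i_def k_def)
  have shift: "R ^^ (a + k) = R ^^ a" if "i \<le> a" for a
  proof -
    have "a = i + (a - i)" "a + k = (i + k) + (a - i)" using that by simp_all
    then show ?thesis using eq by (metis relpow_add)
  qed
  have "R ^^ (a + j * k) = R ^^ a" if "i \<le> a" for a j
  proof (induction j)
    case (Suc j)
    then show ?case using shift[of "a + j * k"] that by (simp add: algebra_simps)
  qed simp
  then have "R ^^ (i * k + i * k) = R ^^ (i * k)" using k by simp
  then show ?thesis using i k by (intro exI[of _ "i * k"]) simp
qed

context cell_substitution
begin

text \<open>
  With \<open>u p + v q = 1\<close>, the value \<open>\<kappa>\<close> is the transverse position modulo \<open>p q\<close> of the staircase path of the
  tiling: up to the drift \<open>\<delta>\<close>, common to all tilings, it counts the unit cells of type \<open>0\<close>.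
\<close>

lemma phase:
  obtains \<kappa> :: "nat \<times> nat \<Rightarrow> int" and \<delta> :: int where
    "\<And>c d. c \<in> cells \<Longrightarrow> d \<in> cells \<Longrightarrow> int (w 0 * w 1) dvd \<kappa> d - \<kappa> c \<Longrightarrow> meeting c d"
    "\<And>X n. fixed_cells X \<Longrightarrow>
      int (w 0 * w 1) dvd \<kappa> (X (Suc n)) - (\<kappa> (X n) + \<delta> + of_bool (fst (X n) = 0))"
proof -
  define p q where "p = int (w 0)" and "q = int (w 1)"
  have pq: "p > 0" "q > 0" "int (w 0 * w 1) = p * q" using w_pos by (auto simp: p_def q_def)
  have "coprime p q" using w_coprime by (simp add: p_def q_def)
  then obtain u v where uv: "u * p + v * q = 1" using bezout_int[of p q] by auto
  have cop: "coprime p (v * q)" "coprime q (u * p)"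
  proof -
    have "x dvd 1" if "x dvd p" "x dvd v * q" for x
      using that uv by (metis dvd_add dvd_mult)
    then show "coprime p (v * q)" by (rule coprimeI)
    have "x dvd 1" if "x dvd q" "x dvd u * p" for x
      using that uv by (metis dvd_add dvd_mult)
    then show "coprime q (u * p)" by (rule coprimeI)
  qed
  \<comment> \<open>A step on a tile of type 0 adds \<open>v * q\<close> and one of type 1 subtracts
    \<open>u * p\<close>. These increments differ by 1, and along a whole tile they add up to a
    multiple of \<open>p * q\<close>, so restarting at 0 is consistent.\<close>
  define \<kappa> :: "nat \<times> nat \<Rightarrow> int" where
    "\<kappa> c = (if fst c = 0 then int (snd c) * (v * q) else - (int (snd c) * (u * p)))" for c
  show ?thesis
  proof (rule that[of \<kappa> "- (u * p)"])
    fix c d assume cd: "c \<in> cells" "d \<in> cells" and dv: "int (w 0 * w 1) dvd \<kappa> d - \<kappa> c"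
    then have dp: "p dvd \<kappa> d - \<kappa> c" and dq: "q dvd \<kappa> d - \<kappa> c"
      using pq(3) by (auto intro: dvd_trans[of _ "p * q"])
    obtain i s j t where c: "c = (i, s)" and d: "d = (j, t)" by (cases c, cases d)
    have st: "i \<in> {0, 1}" "s < w i" "j \<in> {0, 1}" "t < w j"
      using cd by (auto simp: cells_def c d)
    \<comment> \<open>The offset is split by type: modulo \<open>p\<close> only
      \<open>\<kappa>0\<close> matters and modulo \<open>q\<close> only \<open>\<kappa>1\<close>,
      and each is smaller than its modulus.\<close>
    define \<kappa>0 \<kappa>1 where "\<kappa>0 k r = (if k = (0::nat) then int r else 0)"
      and "\<kappa>1 k r = (if k = (0::nat) then 0 else int r)" for k r
    have \<kappa>: "\<kappa> (k, r) = \<kappa>0 k r * (v * q) - \<kappa>1 k r * (u * p)" for k r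
      by (simp add: \<kappa>_def \<kappa>0_def \<kappa>1_def)
    have "p dvd (\<kappa>0 j t - \<kappa>0 i s) * (v * q)"
    proof -
      have "(\<kappa>0 j t - \<kappa>0 i s) * (v * q) = (\<kappa> d - \<kappa> c) + p * ((\<kappa>1 j t - \<kappa>1 i s) * u)"
        by (simp add: c d \<kappa> algebra_simps)
      then show ?thesis using dp by (metis dvd_add dvd_triv_left)
    qed
    then have "p dvd \<kappa>0 j t - \<kappa>0 i s" using cop(1) by (simp add: coprime_dvd_mult_left_iff)
    moreover have "\<bar>\<kappa>0 j t - \<kappa>0 i s\<bar> < p"
      using st pq by (auto simp: \<kappa>0_def p_def)
    ultimately have e0: "\<kappa>0 j t = \<kappa>0 i s"
      using zdvd_not_zless by (metis abs_of_pos dvd_imp_le_int eq_iff_diff_eq_0 not_less pq(1))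
    have "q dvd (\<kappa>1 j t - \<kappa>1 i s) * (u * p)"
    proof -
      have "(\<kappa>1 j t - \<kappa>1 i s) * (u * p) = q * ((\<kappa>0 j t - \<kappa>0 i s) * v) - (\<kappa> d - \<kappa> c)"
        by (simp add: c d \<kappa> algebra_simps)
      then show ?thesis using dq by (metis dvd_diff dvd_triv_left)
    qed
    then have "q dvd \<kappa>1 j t - \<kappa>1 i s" using cop(2) by (simp add: coprime_dvd_mult_left_iff)
    moreover have "\<bar>\<kappa>1 j t - \<kappa>1 i s\<bar> < q"
      using st pq by (auto simp: \<kappa>1_def q_def)
    ultimately have e1: "\<kappa>1 j t = \<kappa>1 i s"
      by (metis abs_of_pos dvd_imp_le_int eq_iff_diff_eq_0 not_less pq(2))
    \<comment> \<open>Equal types give equal offsets; different types force both offsets to be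
      0.\<close>
    show "meeting c d"
      using e0 e1 st by (auto simp: c d meeting_def \<kappa>0_def \<kappa>1_def split: if_splits)
  next
    fix X n assume X: "fixed_cells X"
    obtain i s where xn: "X n = (i, s)" by (cases "X n")
    have i: "i \<in> {0, 1}" "s < w i" using fixed_cellsD(1)[OF X, of n] xn by (auto simp: cells_def)
    have uv': "v * q = 1 - u * p" using uv by simp
    show "int (w 0 * w 1) dvd \<kappa> (X (Suc n)) - (\<kappa> (X n) + - (u * p) + of_bool (fst (X n) = 0))"
    proof (cases "Suc s < w i")
      case True
      then have "X (Suc n) = (i, Suc s)" using fixed_cellsD(4)[OF X, of n] xn by simp
      then have "\<kappa> (X (Suc n)) - (\<kappa> (X n) + - (u * p) + of_bool (fst (X n) = 0)) = 0"
        using uv i xn by (auto simp: \<kappa>_def algebra_simps)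
      then show ?thesis by simp
    next
      case False
      then have "snd (X (Suc n)) = 0" using fixed_cellsD(5)[OF X, of n] xn by simp
      then have 0: "\<kappa> (X (Suc n)) = 0" by (simp add: \<kappa>_def)
      have s: "s = w i - 1" using False i by simp
      have "\<kappa> (X n) + - (u * p) + of_bool (fst (X n) = 0) = p * q * (if i = 0 then v else - u)"
      proof (cases "i = 0")
        case True
        then have "int s = p - 1" using s w_pos by (simp add: p_def)
        moreover have "\<kappa> (X n) + - (u * p) + of_bool (fst (X n) = 0) = int s * (v * q) + v * q"
          using True xn uv' by (simp add: \<kappa>_def)
        moreover have "\<dots> = (int s + 1) * (q * v)" by (simp add: algebra_simps)
        ultimately show ?thesis using True by simp
      next
        case False
        then have "int s = q - 1" using s i w_pos by (simp add: q_def)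
        moreover have "\<kappa> (X n) + - (u * p) + of_bool (fst (X n) = 0) = - ((int s + 1) * (u * p))"
          using False xn by (simp add: \<kappa>_def algebra_simps)
        ultimately show ?thesis using False by simp
      qed
      then show ?thesis unfolding 0 pq(3) by simp
    qed
  qed
qed

definition reachable :: "(nat \<Rightarrow> nat \<times> nat) \<Rightarrow> (nat \<Rightarrow> nat \<times> nat) \<Rightarrow> nat \<Rightarrow> nat \<Rightarrow> ((nat \<times> nat) \<times> (nat \<times> nat)) set" where
  "reachable X Y K n = (\<lambda>r. (X (L ^ K * n + r), Y (L ^ K * n + r))) ` {..<L ^ K}"

lemma reachable_cong:
  assumes "fixed_cells X" "fixed_cells Y" "X n = X m" "Y n = Y m"
  shows "reachable X Y K n = reachable X Y K m"
  unfolding reachable_def using transfer[OF assms(1,1,3)] transfer[OF assms(2,2,4)] by (intro image_cong) auto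

text \<open>Descending \<open>K\<close> levels is the \<open>K\<close>-th power of the relation on
  pairs that descends one level, and a finite relation has an idempotent power.\<close>

lemma reachable_idempotent:
  assumes X: "fixed_cells X" and Y: "fixed_cells Y"
  obtains h where "h > 0" "\<And>n. reachable X Y (h + h) n = reachable X Y h n"
proof -
  define R where "R = {((X n, Y n), (X (L * n + r), Y (L * n + r))) | n r. r < L}"
  have pow: "R ^^ K = {((X n, Y n), z) | n z. z \<in> reachable X Y K n}" if "K > 0" for K
    using that
  proof (induction K rule: nat_induct_non_zero)
    case 1
    then show ?case by (fastforce simp: R_def reachable_def)
  next
    case (Suc K)
    show ?case
    proof (intro Set.set_eqI iffI)
      fix e assume "e \<in> R ^^ Suc K"
      then obtain n m r s where r: "r < L ^ K" and s: "s < L"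
        and e: "e = ((X n, Y n), (X (L * m + s), Y (L * m + s)))"
        and m: "X m = X (L ^ K * n + r)" "Y m = Y (L ^ K * n + r)"
        using Suc.IH by (fastforce simp: R_def reachable_def)
      have "X (L ^ 1 * m + s) = X (L ^ 1 * (L ^ K * n + r) + s)"
           "Y (L ^ 1 * m + s) = Y (L ^ 1 * (L ^ K * n + r) + s)"
        using s transfer[OF X X m(1), of s 1] transfer[OF Y Y m(2), of s 1] by simp_all
      then have "(X (L * m + s), Y (L * m + s)) =
          (X (L ^ (K + 1) * n + (L ^ 1 * r + s)), Y (L ^ (K + 1) * n + (L ^ 1 * r + s)))"
        unfolding power_index by simp
      moreover have "L ^ 1 * r + s < L ^ (K + 1)" using r s by (intro block_index) auto
      ultimately show "e \<in> {((X n, Y n), z) | n z. z \<in> reachable X Y (Suc K) n}"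
        unfolding e reachable_def Suc_eq_plus1 by blast
    next
      fix e assume "e \<in> {((X n, Y n), z) | n z. z \<in> reachable X Y (Suc K) n}"
      then obtain n r where r: "r < L ^ Suc K"
        and e: "e = ((X n, Y n), (X (L ^ Suc K * n + r), Y (L ^ Suc K * n + r)))"
        by (auto simp: reachable_def)
      define m where "m = L ^ K * n + r div L"
      have "r div L < L ^ K" using r by (simp add: less_mult_imp_div_less mult.commute)
      then have "((X n, Y n), (X m, Y m)) \<in> R ^^ K"
        unfolding Suc.IH m_def reachable_def by blast
      moreover have "((X m, Y m), (X (L * m + r mod L), Y (L * m + r mod L))) \<in> R"
        unfolding R_def using mod_less_divisor[of L r] L by fastforce
      moreover have "L * m + r mod L = L ^ Suc K * n + r" by (simp add: m_def algebra_simps)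
      ultimately show "e \<in> R ^^ Suc K" unfolding e by auto
    qed
  qed
  have "R \<subseteq> (cells \<times> cells) \<times> (cells \<times> cells)"
    using fixed_cellsD(1)[OF X] fixed_cellsD(1)[OF Y] by (auto simp: R_def)
  then obtain h where h: "h > 0" "R ^^ (h + h) = R ^^ h"
    using idempotent_relpow[of "cells \<times> cells" R] finite_cells by auto
  have "reachable X Y K n = (R ^^ K) `` {(X n, Y n)}" if "K > 0" for K n
    unfolding pow[OF that] using reachable_cong[OF X Y] by blast
  then have "reachable X Y (h + h) n = reachable X Y h n" for n
    using h by simp
  then show ?thesis using that h(1) by blast
qed

end

section \<open>Trapped classes: existence, determinism and periodicity\<close>

context cell_substitution
begin

text \<open>
  A suitable level \<open>h\<close> makes the class aperiodic: from each pair in \<open>C\<close>, all of \<open>C\<close> is reached in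
  exactly \<open>h\<close> steps. So block averages over \<open>C\<close> contract.
\<close>

definition trapped_class where
  "trapped_class X Y h C \<longleftrightarrow> h > 0 \<and> finite C \<and>
     (\<forall>m. (X m, Y m) \<in> C \<longrightarrow> reachable X Y h m = C) \<and> (\<forall>(c, d)\<in>C. \<not> meeting c d)"

lemma trapped_class_swap:
  assumes "trapped_class X Y h C"
  shows "trapped_class Y X h (C\<inverse>)"
proof -
  have "reachable Y X h m = (reachable X Y h m)\<inverse>" for m
    by (auto simp: reachable_def)
  then show ?thesis
    using assms by (auto simp: trapped_class_def meeting_def)
qed

lemma trapped_class_closed:
  assumes C: "trapped_class X Y h C" and m: "(X m, Y m) \<in> C"
  shows "r < L ^ (h * j) \<Longrightarrow> (X (L ^ (h * j) * m + r), Y (L ^ (h * j) * m + r)) \<in> C"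
proof (induction j arbitrary: r)
  case (Suc j)
  have "L ^ (h * Suc j) = L ^ h * L ^ (h * j)" by (simp add: power_add)
  then have "r div L ^ h < L ^ (h * j)"
    using Suc.prems by (simp add: less_mult_imp_div_less mult.commute)
  then have "reachable X Y h (L ^ (h * j) * m + r div L ^ h) = C"
    using Suc.IH C by (auto simp: trapped_class_def)
  moreover have "L ^ h * (L ^ (h * j) * m + r div L ^ h) + r mod L ^ h = L ^ (h * Suc j) * m + r"
    by (simp add: power_add algebra_simps)
  moreover have "r mod L ^ h < L ^ h" using L_pos by simp
  ultimately show ?case unfolding reachable_def by (metis (no_types, lifting) imageI lessThan_iff)
qed (use m in simp)

text \<open>Take a trapped index whose reachable set at an idempotent level is of least size. From
  each pair in this set one reaches only pairs of the set, by idempotence, and not fewer, by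
  minimality.\<close>

lemma trapped_class_exists:
  assumes X: "fixed_cells X" and Y: "fixed_cells Y"
    and trap: "\<And>K r. r < L ^ K \<Longrightarrow> \<not> meeting (X (L ^ K * c + r)) (Y (L ^ K * c + r))"
  obtains h C n where "trapped_class X Y h C" "(X n, Y n) \<in> C"
proof -
  obtain h where h: "h > 0" and idem: "\<And>n. reachable X Y (h + h) n = reachable X Y h n"
    using reachable_idempotent[OF X Y] by blast
  define T where "T = {n. \<forall>K r. r < L ^ K \<longrightarrow> \<not> meeting (X (L ^ K * n + r)) (Y (L ^ K * n + r))}"
  have "c \<in> T" using trap by (simp add: T_def)
  then obtain c0 where c0: "c0 \<in> T"
    and min: "\<And>n. n \<in> T \<Longrightarrow> card (reachable X Y h c0) \<le> card (reachable X Y h n)"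
    using ex_has_least_nat[of "\<lambda>n. n \<in> T" c "\<lambda>n. card (reachable X Y h n)"] by blast
  define C where "C = reachable X Y h c0"
  have fin: "finite C" by (simp add: C_def reachable_def)
  have inT: "L ^ K * n + r \<in> T" if "n \<in> T" "r < L ^ K" for n K r
    unfolding T_def
  proof (intro CollectI allI impI)
    fix b s assume "s < L ^ b"
    then show "\<not> meeting (X (L ^ b * (L ^ K * n + r) + s)) (Y (L ^ b * (L ^ K * n + r) + s))"
      unfolding power_index using that(1) block_index[OF that(2)] unfolding T_def by blast
  qed
  have cong: "m \<in> T" if "n \<in> T" "X n = X m" "Y n = Y m" for n m
    unfolding T_def
  proof (intro CollectI allI impI)
    fix K r assume r: "r < L ^ K"
    then show "\<not> meeting (X (L ^ K * m + r)) (Y (L ^ K * m + r))"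
      using that(1) transfer[OF X X that(2) r] transfer[OF Y Y that(3) r] unfolding T_def by fastforce
  qed
  have key: "m \<in> T \<and> reachable X Y h m = C" if "(X m, Y m) \<in> C" for m
  proof -
    obtain r where r: "r < L ^ h" "X m = X (L ^ h * c0 + r)" "Y m = Y (L ^ h * c0 + r)"
      using \<open>(X m, Y m) \<in> C\<close> by (auto simp: C_def reachable_def)
    have mT: "m \<in> T" using cong[OF inT[OF c0 r(1)]] r by simp
    have "reachable X Y h (L ^ h * c0 + r) \<subseteq> reachable X Y (h + h) c0"
    proof
      fix z assume "z \<in> reachable X Y h (L ^ h * c0 + r)"
      then obtain s where "s < L ^ h"
        and "z = (X (L ^ (h + h) * c0 + (L ^ h * r + s)), Y (L ^ (h + h) * c0 + (L ^ h * r + s)))"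
        unfolding reachable_def power_index by blast
      then show "z \<in> reachable X Y (h + h) c0"
        unfolding reachable_def using block_index[OF r(1)] by blast
    qed
    then have "reachable X Y h m \<subseteq> C"
      using idem reachable_cong[OF X Y r(2,3)] by (simp add: C_def)
    then have "reachable X Y h m = C"
      using card_seteq[OF fin] min[OF mT] by (simp add: C_def)
    then show ?thesis using mT by blast
  qed
  have nomeet: "\<not> meeting (X m) (Y m)" if "m \<in> T" for m
  proof -
    have "0 < L ^ 0 \<longrightarrow> \<not> meeting (X (L ^ 0 * m + 0)) (Y (L ^ 0 * m + 0))"
      using that unfolding T_def by blast
    then show ?thesis by simp
  qed
  have "\<not> meeting a b" if ab: "(a, b) \<in> C" for a b
  proof -
    obtain m where "a = X m" "b = Y m" using ab by (auto simp: C_def reachable_def)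
    then show ?thesis using key nomeet ab by blast
  qed
  then have "trapped_class X Y h C"
    unfolding trapped_class_def using h fin key by auto
  moreover have "(X (L ^ h * c0 + 0), Y (L ^ h * c0 + 0)) \<in> C"
    unfolding C_def reachable_def using L_pos by blast
  ultimately show ?thesis using that by blast
qed

lemma power_less_multiple: "h > 0 \<Longrightarrow> n < L ^ (h * n)"
proof -
  assume "h > 0"
  then have "n \<le> h * n" by simp
  then have "L ^ n \<le> L ^ (h * n)" using L by (intro power_increasing) auto
  then show ?thesis using less_power[of n] by linarith
qed

text \<open>
  The blocks at \<open>n1\<close> and \<open>n2\<close> below have the same second component, while their first components copy
  \<open>X\<close> and \<open>Y\<close> over a trapped block at \<open>c\<close>. So the difference \<open>E\<close> of the two gaps never vanishes; it changes
  by at most \<open>1\<close> per step, hence keeps its sign, and the two averages of \<open>D\<close> differ by at least \<open>1\<close>.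
\<close>

lemma trapped_class_no_branching:
  assumes X: "fixed_cells X" and Y: "fixed_cells Y"
    and C: "trapped_class X Y h C" and m: "(X m, Y m) \<in> C" and m': "(X m', Y m') \<in> C"
    and eq: "Y m = Y m'" and start: "X m = X 0" "X m' = Y 0"
  shows False
proof -
  obtain \<kappa> \<delta> where
    sep: "\<And>c d. c \<in> cells \<Longrightarrow> d \<in> cells \<Longrightarrow> int (w 0 * w 1) dvd \<kappa> d - \<kappa> c \<Longrightarrow> meeting c d"
    and adv: "\<And>X n. fixed_cells X \<Longrightarrow>
      int (w 0 * w 1) dvd \<kappa> (X (Suc n)) - (\<kappa> (X n) + \<delta> + of_bool (fst (X n) = 0))"
    using phase by blast
  define N where "N = int (w 0 * w 1)"
  have N: "N > 0" using w_pos by (simp add: N_def)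
  have h: "h > 0" using C by (simp add: trapped_class_def)
  define D where "D n = (\<kappa> (Y n) - \<kappa> (X n)) mod N" for n
  have D: "0 < D n \<and> D n < N" if "(X n, Y n) \<in> C" for n
  proof -
    have "\<not> meeting (X n) (Y n)" using C that by (auto simp: trapped_class_def)
    then have "\<not> N dvd \<kappa> (Y n) - \<kappa> (X n)"
      using sep[OF fixed_cellsD(1)[OF X] fixed_cellsD(1)[OF Y]] unfolding N_def by blast
    then have "D n \<noteq> 0" by (auto simp: D_def dvd_eq_mod_eq_0)
    moreover have "0 \<le> D n" "D n < N" using N by (simp_all add: D_def)
    ultimately show ?thesis by simp
  qed
  have D_cong: "N dvd D n - (\<kappa> (Y n) - \<kappa> (X n))" for n
    unfolding D_def by (metis dvd_minus_mod dvd_diff_commute)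
  have D_step: "D (Suc n) = D n + of_bool (fst (Y n) = 0) - of_bool (fst (X n) = 0)"
    if "(X n, Y n) \<in> C" "(X (Suc n), Y (Suc n)) \<in> C" for n
  proof -
    let ?e = "of_bool (fst (Y n) = 0) - of_bool (fst (X n) = 0) :: int"
    have "D (Suc n) - (D n + ?e) =
        (D (Suc n) - (\<kappa> (Y (Suc n)) - \<kappa> (X (Suc n)))) - (D n - (\<kappa> (Y n) - \<kappa> (X n)))
        + (\<kappa> (Y (Suc n)) - (\<kappa> (Y n) + \<delta> + of_bool (fst (Y n) = 0)))
        - (\<kappa> (X (Suc n)) - (\<kappa> (X n) + \<delta> + of_bool (fst (X n) = 0)))"
      by (simp add: algebra_simps)
    moreover have "N dvd \<dots>"
      using adv[OF X, of n] adv[OF Y, of n] unfolding N_def[symmetric]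
      by (intro dvd_diff[OF dvd_add[OF dvd_diff[OF D_cong D_cong]]])
    ultimately have dv: "N dvd D (Suc n) - (D n + ?e)" by (simp only:)
    have "\<bar>?e\<bar> \<le> 1" by (auto simp: of_bool_def)
    \<comment> \<open>Two values strictly between 0 and \<open>N\<close> differ by at most
      \<open>N - 2\<close>, so a step of size at most 1 cannot wrap around.\<close>
    then have "\<bar>D (Suc n) - (D n + ?e)\<bar> < N" using D[OF that(1)] D[OF that(2)] by linarith
    then have "D (Suc n) - (D n + ?e) = 0"
      using dvd_imp_le_int[OF _ dv] N by linarith
    then show ?thesis by linarith
  qed
  define Q where "Q = L ^ h"
  have Q: "Q > 0" using L_pos by (simp add: Q_def)
  have Qj: "Q ^ j = L ^ (h * j)" for j by (simp add: Q_def power_mult)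
  define c where "c = m"
  have c: "(X c, Y c) \<in> C" using m by (simp add: c_def)
  define f where "f n = real_of_int (D n)" for n
  define S where "S n \<longleftrightarrow> (X n, Y n) \<in> C" for n
  \<comment> \<open>At this level the averages of \<open>D\<close> over blocks of the class spread
    by less than 1, while nonzero integers of constant sign average to at least 1 in
    modulus.\<close>
  obtain j where j: "(1 - 1 / real Q) ^ j * real_of_int N < 1"
    using contraction_small[OF Q, of 1] by auto
  have "\<exists>lo hi. (\<forall>n. S n \<longrightarrow> lo \<le> block_avg f (Q ^ j) n \<and> block_avg f (Q ^ j) n \<le> hi) \<and>
      hi - lo \<le> (1 - 1 / real Q) ^ j * real_of_int N"
  proof (rule block_avg_contraction[OF Q])
    fix n r assume "S n" "r < Q"
    then show "S (Q * n + r)"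
      using trapped_class_closed[OF C, of n r 1] by (simp add: S_def Q_def)
  next
    fix j
    have "block_avg f (Q ^ j) n = block_avg f (Q ^ j) c" if "X n = X c" "Y n = Y c" for n
      unfolding block_avg_def f_def D_def Qj
      using transfer[OF X X that(1)] transfer[OF Y Y that(2)] by simp
    moreover have "\<exists>r<Q. X (Q * n + r) = X c \<and> Y (Q * n + r) = Y c" if "S n" for n
    proof -
      have "(X c, Y c) \<in> reachable X Y h n" using C c that by (auto simp: trapped_class_def S_def)
      then show ?thesis by (auto simp: reachable_def Q_def)
    qed
    ultimately show "\<exists>v. \<forall>n. S n \<longrightarrow> (\<exists>r<Q. block_avg f (Q ^ j) (Q * n + r) = v)"
      by metis
  next
    fix n assume "S n"
    then show "0 \<le> f n \<and> f n \<le> real_of_int N" using D[of n] by (simp add: S_def f_def)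
  qed
  then obtain lo hi where lh: "hi - lo < 1"
    and bd: "\<And>n. (X n, Y n) \<in> C \<Longrightarrow> lo \<le> block_avg f (Q ^ j) n \<and> block_avg f (Q ^ j) n \<le> hi"
    using j unfolding S_def by force
  define B where "B = L ^ (h * j)"
  have B: "B > 0" unfolding B_def by (rule L_pos)
  \<comment> \<open>These indices retrace from \<open>m\<close> and \<open>m'\<close> the descent
    from \<open>0\<close> to \<open>c\<close>. As the first components there are \<open>X 0\<close>
    and \<open>Y 0\<close>, they copy \<open>X c\<close> and \<open>Y c\<close>; the second
    components agree because \<open>Y m = Y m'\<close>.\<close>
  define n1 n2 where "n1 = L ^ (h * c) * m + c" and "n2 = L ^ (h * c) * m' + c"
  have n1: "(X n1, Y n1) \<in> C" and n2: "(X n2, Y n2) \<in> C"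
    unfolding n1_def n2_def using power_less_multiple[OF h]
    by (intro trapped_class_closed[OF C] m m'; simp)+
  have cell1: "X n1 = X c" and cell2: "X n2 = Y c" and cellY: "Y n1 = Y n2"
    using transfer[OF X X start(1), of c "h * c"] transfer[OF X Y start(2), of c "h * c"]
      transfer[OF Y Y eq, of c "h * c"] power_less_multiple[OF h, of c]
    by (simp_all add: n1_def n2_def)
  define E where "E r = D (B * n1 + r) - D (B * n2 + r)" for r
  have inC: "(X (B * n + r), Y (B * n + r)) \<in> C" if "(X n, Y n) \<in> C" "r < B" for n r
    using trapped_class_closed[OF C that(1)] that(2) by (simp add: B_def)
  have sync: "X (B * n1 + r) = X (B * c + r)" "X (B * n2 + r) = Y (B * c + r)"
      "Y (B * n1 + r) = Y (B * n2 + r)" if "r < B" for r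
    using transfer[OF X X cell1, of r "h * j"] transfer[OF X Y cell2, of r "h * j"]
      transfer[OF Y Y cellY, of r "h * j"] that by (simp_all add: B_def)
  \<comment> \<open>The terms from \<open>Y\<close> cancel in \<open>E r\<close>, which is thus
    congruent modulo \<open>N\<close> to the gap of the two paths in the block at \<open>c\<close>;
    this is nonzero, as that block stays in the class.\<close>
  have E0: "E r \<noteq> 0" if r: "r < B" for r
  proof
    assume "E r = 0"
    moreover have "N dvd (D (B * n1 + r) - (\<kappa> (Y (B * n1 + r)) - \<kappa> (X (B * n1 + r))))
        - (D (B * n2 + r) - (\<kappa> (Y (B * n2 + r)) - \<kappa> (X (B * n2 + r))))" (is "N dvd ?d")
      by (intro dvd_diff D_cong)
    moreover have "?d = E r + (\<kappa> (X (B * c + r)) - \<kappa> (Y (B * c + r)))"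
      unfolding E_def sync(1,2)[OF r, symmetric] by (simp add: sync(3)[OF r])
    ultimately have "N dvd \<kappa> (X (B * c + r)) - \<kappa> (Y (B * c + r))" by simp
    then have "N dvd \<kappa> (Y (B * c + r)) - \<kappa> (X (B * c + r))" by (metis dvd_diff_commute)
    then have "meeting (X (B * c + r)) (Y (B * c + r))"
      using sep[OF fixed_cellsD(1)[OF X] fixed_cellsD(1)[OF Y]] unfolding N_def by blast
    then show False using inC[OF c r] C by (auto simp: trapped_class_def)
  qed
  have E_step: "\<bar>E (Suc r) - E r\<bar> \<le> 1" if r: "Suc r < B" for r
  proof -
    have r': "r < B" using r by simp
    have "E (Suc r) - E r = of_bool (fst (X (B * n2 + r)) = 0) - of_bool (fst (X (B * n1 + r)) = 0)"
      using D_step[of "B * n1 + r"] D_step[of "B * n2 + r"] inC[OF n1 r] inC[OF n1 r'] inC[OF n2 r] inC[OF n2 r']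
        sync(3)[OF r'] by (simp add: E_def)
    then show ?thesis by (auto simp: of_bool_def)
  qed
  have sign: "\<forall>r<B. 0 < s * E r" if s: "s \<in> {1, -1}" "0 < s * E 0" for s
  proof (intro allI)
    fix r
    show "r < B \<longrightarrow> 0 < s * E r"
    proof (induction r)
      case (Suc r)
      then show ?case using E_step[of r] E0[of "Suc r"] s(1) by fastforce
    qed (use s in simp)
  qed
  have avg: "block_avg f (Q ^ j) n1 - block_avg f (Q ^ j) n2 = (\<Sum>r<B. real_of_int (E r)) / B"
    unfolding Qj B_def[symmetric] block_avg_def f_def E_def
    by (simp add: sum_subtractf diff_divide_distrib)
  have "E 0 \<noteq> 0" using E0 B by simp
  then consider "0 < 1 * E 0" | "0 < -1 * E 0" by linarith
  then show False
  proof cases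
    case 1
    then have "\<forall>r<B. 1 \<le> real_of_int (E r)" using sign[of 1] by force
    then have "(\<Sum>r<B. 1) \<le> (\<Sum>r<B. real_of_int (E r))" by (intro sum_mono) auto
    then have "1 \<le> (\<Sum>r<B. real_of_int (E r)) / B" using B by (simp add: field_simps)
    then show False using avg bd[OF n1] bd[OF n2] lh by linarith
  next
    case 2
    then have "\<forall>r<B. real_of_int (E r) \<le> -1" using sign[of "-1"] by force
    then have "(\<Sum>r<B. real_of_int (E r)) \<le> (\<Sum>r<B. -1)" by (intro sum_mono) auto
    then have "(\<Sum>r<B. real_of_int (E r)) / B \<le> -1" using B by (simp add: field_simps)
    then show False using avg bd[OF n1] bd[OF n2] lh by linarith
  qed
qed

text \<open>The only tile starts are \<open>X 0\<close> and \<open>Y 0\<close>, which differ because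
  equal ones would make the pair at \<open>m\<close> meet. So two different values would be the
  branching just excluded.\<close>

lemma trapped_class_deterministic:
  assumes X: "fixed_cells X" and Y: "fixed_cells Y"
    and C: "trapped_class X Y h C" and m: "(X m, Y m) \<in> C" and m': "(X m', Y m') \<in> C"
    and eq: "Y m = Y m'" and start: "snd (X m) = 0" "snd (X m') = 0"
  shows "X m = X m'"
proof (rule ccontr)
  assume ne: "X m \<noteq> X m'"
  have "X 0 \<noteq> Y 0"
  proof
    assume "X 0 = Y 0"
    then have "X m = Y m" using transfer[OF X Y, of 0 0 m m] less_power[of m] by simp
    then show False using m C by (auto simp: trapped_class_def meeting_def)
  qed
  moreover obtain i j k l where "i \<in> {0, 1}" "X m = (i, 0)" "j \<in> {0, 1}" "X m' = (j, 0)"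
      "k \<in> {0, 1}" "X 0 = (k, 0)" "l \<in> {0, 1}" "Y 0 = (l, 0)"
    by (metis fixed_cells_start[OF X start(1)] fixed_cells_start[OF X start(2)]
      fixed_cells_start[OF X fixed_cellsD(2)[OF X]] fixed_cells_start[OF Y fixed_cellsD(2)[OF Y]])
  ultimately have "X m = X 0 \<and> X m' = Y 0 \<or> X m' = X 0 \<and> X m = Y 0" using ne by auto
  then show False
    using trapped_class_no_branching[OF X Y C m m' eq] trapped_class_no_branching[OF X Y C m' m eq[symmetric]]
    by blast
qed

text \<open>Two tiles never start together in the class, so at each step at least one cell is
  determined by the current pair, and it determines the other. This makes long blocks periodic after
  a preperiod; and every initial piece of \<open>X\<close> or of \<open>Y\<close> has a copy in such
  a block.\<close>

lemma trapped_class_periodic: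
  assumes X: "fixed_cells X" and Y: "fixed_cells Y"
    and C: "trapped_class X Y h C" and c: "(X c, Y c) \<in> C"
  shows "\<exists>P>0. \<forall>n. X (n + P) = X n \<and> Y (n + P) = Y n"
proof -
  define P where "P = (fact (card C) :: nat)"
  have h: "h > 0" and fin: "finite C" using C by (auto simp: trapped_class_def)
  have nomeet: "\<not> meeting (X n) (Y n)" if "(X n, Y n) \<in> C" for n
    using that C by (auto simp: trapped_class_def)
  have det: "(X (Suc m), Y (Suc m)) = (X (Suc m'), Y (Suc m'))"
    if eq: "X m = X m'" "Y m = Y m'"
      and S: "(X (Suc m), Y (Suc m)) \<in> C" "(X (Suc m'), Y (Suc m')) \<in> C" for m m'
  proof (cases "Suc (snd (X m)) < w (fst (X m))")
    case True
    then have x: "X (Suc m) = X (Suc m')"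
      using fixed_cellsD(4)[OF X, of m] fixed_cellsD(4)[OF X, of m'] eq by simp
    show ?thesis
    proof (cases "Suc (snd (Y m)) < w (fst (Y m))")
      case True
      then show ?thesis
        using x fixed_cellsD(4)[OF Y, of m] fixed_cellsD(4)[OF Y, of m'] eq by simp
    next
      case False
      then have "Y (Suc m) = Y (Suc m')"
        using trapped_class_deterministic[OF Y X trapped_class_swap[OF C], of "Suc m" "Suc m'"]
          S x fixed_cellsD(5)[OF Y, of m] fixed_cellsD(5)[OF Y, of m'] eq by simp
      then show ?thesis using x by simp
    qed
  next
    case False
    then have x: "snd (X (Suc m)) = 0" "snd (X (Suc m')) = 0"
      using fixed_cellsD(5)[OF X, of m] fixed_cellsD(5)[OF X, of m'] eq by simp_all
    then have "Suc (snd (Y m)) < w (fst (Y m))"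
      using nomeet[OF S(1)] fixed_cellsD(5)[OF Y, of m] by (auto simp: meeting_def)
    then have y: "Y (Suc m) = Y (Suc m')"
      using fixed_cellsD(4)[OF Y, of m] fixed_cellsD(4)[OF Y, of m'] eq by simp
    then show ?thesis
      using trapped_class_deterministic[OF X Y C S y x] by simp
  qed
  have win: "(X (L ^ (h * J) * c + (t + P)), Y (L ^ (h * J) * c + (t + P)))
      = (X (L ^ (h * J) * c + t), Y (L ^ (h * J) * c + t))"
    if "card C \<le> t" "t + P < L ^ (h * J)" for J t
    using that unfolding P_def
  proof (intro deterministic_window[where g = "\<lambda>t. (X (L ^ (h * J) * c + t), Y (L ^ (h * J) * c + t))" and W = "L ^ (h * J)"] fin)
    fix t assume "t < L ^ (h * J)"
    then show "(X (L ^ (h * J) * c + t), Y (L ^ (h * J) * c + t)) \<in> C"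
      by (rule trapped_class_closed[OF C c])
  next
    fix s t assume "Suc s < L ^ (h * J)" "Suc t < L ^ (h * J)"
      and "(X (L ^ (h * J) * c + s), Y (L ^ (h * J) * c + s)) = (X (L ^ (h * J) * c + t), Y (L ^ (h * J) * c + t))"
    then show "(X (L ^ (h * J) * c + Suc s), Y (L ^ (h * J) * c + Suc s)) = (X (L ^ (h * J) * c + Suc t), Y (L ^ (h * J) * c + Suc t))"
      using det[of "L ^ (h * J) * c + s" "L ^ (h * J) * c + t"]
        trapped_class_closed[OF C c, of "Suc s" J] trapped_class_closed[OF C c, of "Suc t" J] by simp
  qed
  \<comment> \<open>Each sequence is treated separately: its own initial cell is found again below
    \<open>c\<close>, and nothing is claimed about the initial pair.\<close>
  have per: "V (r + P) = V r" if V: "fixed_cells V"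
    and win: "\<And>J t. card C \<le> t \<Longrightarrow> t + P < L ^ (h * J) \<Longrightarrow>
      V (L ^ (h * J) * c + (t + P)) = V (L ^ (h * J) * c + t)" for V r
  proof -
    define j0 j where "j0 = card C" and "j = r + P"
    have j: "r + P < L ^ (h * j)" unfolding j_def by (rule power_less_multiple[OF h])
    \<comment> \<open>Starting \<open>card C\<close> cells into a block skips the preperiod; all
      descendants of \<open>m\<close> remain beyond it.\<close>
    define m where "m = L ^ (h * j0) * c + card C"
    obtain i where i: "i \<in> {0, 1}" "V 0 = (i, 0)" using fixed_cells_start[OF V fixed_cellsD(2)[OF V]] .
    obtain K0 where K0: "\<And>K. K \<ge> K0 \<Longrightarrow> \<exists>r<L ^ K. V (L ^ K * m + r) = (i, 0)"
      using reaches_start[OF V i(1)] by blast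
    have "K0 \<le> h * K0" using h by simp
    then obtain r1 where r1: "r1 < L ^ (h * K0)" "V (L ^ (h * K0) * m + r1) = V 0"
      using K0 i(2) by metis
    define m2 where "m2 = L ^ (h * K0) * m + r1"
    \<comment> \<open>In rounds of \<open>h\<close> levels: \<open>j0\<close> make room for the
      preperiod, \<open>K0\<close> find the initial cell again, and \<open>j\<close> unfold a copy
      that reaches position \<open>r + P\<close>.\<close>
    define J where "J = j0 + K0 + j"
    define off where "off = L ^ (h * j) * (L ^ (h * K0) * card C + r1)"
    have "L ^ (h * j) * m2 + u = L ^ (h * J) * c + (off + u)" for u
      by (simp add: m2_def m_def J_def off_def power_add algebra_simps)
    moreover have "V (L ^ (h * j) * m2 + u) = V u" if "u < L ^ (h * j)" for u
      using transfer[OF V V, of m2 0 u "h * j"] r1(2) that by (simp add: m2_def)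
    ultimately have copy: "V (L ^ (h * J) * c + (off + u)) = V u" if "u < L ^ (h * j)" for u
      using that by metis
    have "1 * (1 * card C) \<le> L ^ (h * j) * (L ^ (h * K0) * card C)"
      using L_pos[of "h * j"] L_pos[of "h * K0"] by (intro mult_le_mono) (simp_all add: Suc_le_eq)
    also have "\<dots> \<le> off" by (simp add: off_def)
    finally have off: "card C \<le> off + r" by simp
    have "card C < L ^ (h * j0)" unfolding j0_def by (rule power_less_multiple[OF h])
    then have "L ^ (h * K0) * card C + r1 < L ^ (h * j0 + h * K0)" using r1(1) by (rule block_index)
    then have "off + (r + P) < L ^ ((h * j0 + h * K0) + h * j)"
      unfolding off_def using j by (rule block_index)
    then have "(off + r) + P < L ^ (h * J)" by (simp add: J_def algebra_simps)
    from win[OF off this] show ?thesis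
      using copy[of "r + P"] copy[of r] j by (simp add: add.assoc)
  qed
  have "X (n + P) = X n \<and> Y (n + P) = Y n" for n
    using per[OF X] per[OF Y] win by simp
  moreover have "P > 0" by (simp add: P_def)
  ultimately show ?thesis by blast
qed

theorem pair_frequency:
  fixes P :: "(nat \<times> nat) \<Rightarrow> (nat \<times> nat) \<Rightarrow> bool"
  assumes X: "fixed_cells X" and Y: "fixed_cells Y"
  shows "convergent (\<lambda>N. (\<Sum>k<N. of_bool (P (X k) (Y k))) / real N)"
proof (cases "\<forall>n. \<exists>K. \<exists>r<L ^ K. meeting (X (L ^ K * n + r)) (Y (L ^ K * n + r))")
  case True
  then show ?thesis by (intro meeting_frequency[OF X Y]) blast
next
  case False
  then obtain c where "\<And>K r. r < L ^ K \<Longrightarrow> \<not> meeting (X (L ^ K * c + r)) (Y (L ^ K * c + r))"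
    by blast
  then obtain h C n where "trapped_class X Y h C" "(X n, Y n) \<in> C"
    using trapped_class_exists[OF X Y] by blast
  then obtain p where "p > 0" "\<And>n. X (n + p) = X n \<and> Y (n + p) = Y n"
    using trapped_class_periodic[OF X Y] by blast
  then show ?thesis
    by (intro periodic_average_convergent[of _ p]) auto
qed

end

section \<open>Cells of a tiling with integer tile lengths\<close>

primrec locate :: "(nat \<Rightarrow> nat) \<Rightarrow> (nat \<Rightarrow> nat) \<Rightarrow> nat \<Rightarrow> nat \<times> nat" where
  "locate v x 0 = (0, 0)"
| "locate v x (Suc n) = (let (m, s) = locate v x n in
     if Suc s < v (x m) then (m, Suc s) else (Suc m, 0))"

definition cell :: "(nat \<Rightarrow> nat) \<Rightarrow> (nat \<Rightarrow> nat) \<Rightarrow> nat \<Rightarrow> nat \<times> nat" where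
  "cell v x n = (x (fst (locate v x n)), snd (locate v x n))"

definition tile_start :: "(nat \<Rightarrow> nat) \<Rightarrow> (nat \<Rightarrow> nat) \<Rightarrow> nat \<Rightarrow> nat" where
  "tile_start v x m = (\<Sum>k<m. v (x k))"

text \<open>The finite analogue of \<open>cell\<close>; \<open>(0, 0)\<close> is a default beyond
  the end of the word.\<close>

fun cell_at :: "(nat \<Rightarrow> nat) \<Rightarrow> nat list \<Rightarrow> nat \<Rightarrow> nat \<times> nat" where
  "cell_at v [] t = (0, 0)"
| "cell_at v (i # ys) t = (if t < v i then (i, t) else cell_at v ys (t - v i))"

lemma tile_start_mono: "m \<le> m' \<Longrightarrow> tile_start v x m \<le> tile_start v x m'"
  unfolding tile_start_def by (intro sum_mono2) auto

lemma locate_spec: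
  assumes "\<And>m. v (x m) > 0" "locate v x n = (m, s)"
  shows "n = tile_start v x m + s" "s < v (x m)"
proof -
  have "n = tile_start v x (fst (locate v x n)) + snd (locate v x n) \<and>
      snd (locate v x n) < v (x (fst (locate v x n)))"
  proof (induction n)
    case (Suc n)
    obtain m s where "locate v x n = (m, s)" by (cases "locate v x n")
    then show ?case using Suc assms(1) by (auto simp: tile_start_def)
  qed (simp add: tile_start_def assms(1))
  then show "n = tile_start v x m + s" "s < v (x m)" using assms(2) by simp_all
qed

lemma locate_eq:
  assumes pos: "\<And>m. v (x m) > 0" and s: "s < v (x m)"
  shows "locate v x (tile_start v x m + s) = (m, s)"
proof -
  obtain m' s' where l: "locate v x (tile_start v x m + s) = (m', s')"
    by (cases "locate v x (tile_start v x m + s)")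
  note sp = locate_spec[OF pos l]
  have "m = m'"
  proof (rule linorder_cases[of m m'])
    assume "m < m'"
    then have "tile_start v x (Suc m) \<le> tile_start v x m'" by (intro tile_start_mono) simp
    then show ?thesis using sp s by (simp add: tile_start_def)
  next
    assume "m' < m"
    then have "tile_start v x (Suc m') \<le> tile_start v x m" by (intro tile_start_mono) simp
    then show ?thesis using sp s by (simp add: tile_start_def)
  qed
  then show ?thesis using l sp by simp
qed

lemma cell_at_word:
  assumes pos: "\<And>m. v (x m) > 0"
  shows "(\<And>k. k < length ys \<Longrightarrow> x (m + k) = ys ! k) \<Longrightarrow> t < sum_list (map v ys) \<Longrightarrow>
    cell v x (tile_start v x m + t) = cell_at v ys t"
proof (induction ys arbitrary: m t)
  case (Cons i ys)
  have i: "x m = i" using Cons.prems(1)[of 0] by simp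
  show ?case
  proof (cases "t < v i")
    case True
    then show ?thesis using locate_eq[of v x t m, OF pos] i by (simp add: cell_def)
  next
    case False
    have "cell v x (tile_start v x (Suc m) + (t - v i)) = cell_at v ys (t - v i)"
    proof (rule Cons.IH)
      show "x (Suc m + k) = ys ! k" if "k < length ys" for k
        using Cons.prems(1)[of "Suc k"] that by simp
      show "t - v i < sum_list (map v ys)" using Cons.prems(2) False by simp
    qed
    moreover have "tile_start v x (Suc m) + (t - v i) = tile_start v x m + t"
      using False i by (simp add: tile_start_def)
    ultimately show ?thesis using False by simp
  qed
qed simp

lemma cell_at_occurs:
  assumes "i \<in> set ys" "v i > 0"
  shows "\<exists>t<sum_list (map v ys). cell_at v ys t = (i, 0)"
  using assms
proof (induction ys)
  case (Cons j ys)
  show ?case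
  proof (cases "j = i")
    case True
    then show ?thesis using Cons.prems by (intro exI[of _ 0]) simp
  next
    case False
    then obtain t where "t < sum_list (map v ys)" "cell_at v ys t = (i, 0)" using Cons by auto
    then show ?thesis by (intro exI[of _ "v j + t"]) simp
  qed
qed simp

section \<open>Letters, integer tile lengths and the eigenvalue\<close>

lemma sum_list_letters:
  fixes v :: "nat \<Rightarrow> nat"
  assumes "set ys \<subseteq> {0, 1}"
  shows "sum_list (map v ys) = count_list ys 0 * v 0 + count_list ys 1 * v 1"
  using assms by (induction ys) auto

lemma limit_word_letters:
  assumes sub: "is_substitution \<theta>" and prim: "primitive_substitution \<theta>"
    and a: "a \<in> {0, 1}" and hd: "hd (\<theta> a) = a"
  shows "limit_word \<theta> a k \<in> {0, 1}" "limit_word \<theta> a 0 = a"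
proof -
  note gr = word_grows[OF assms]
  have "set ((subst_word \<theta> ^^ n) [a]) \<subseteq> {0, 1}" for n
  proof (induction n)
    case 0 then show ?case using a by auto
  next
    case (Suc n)
    then show ?case using sub by (fastforce simp: subst_word_def is_substitution_def)
  qed
  then show "limit_word \<theta> a k \<in> {0, 1}"
    using limit_word_eq[OF gr(2) gr(1)[of k]] nth_mem[OF gr(1)[of k]] by auto
  show "limit_word \<theta> a 0 = a" using limit_word_eq[OF gr(2), of 0 0] by simp
qed

text \<open>A zero off the diagonal makes the matrix triangular, and all its powers keep this
  zero.\<close>

lemma primitive_off_diagonal:
  assumes prim: "primitive_substitution \<theta>" and ij: "i \<in> {0, 1}" "j \<in> {0, 1}" "i \<noteq> j"
  shows "count_list (\<theta> i) j > 0"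
proof (rule ccontr)
  let ?M = "subst_matrix \<theta>"
  assume "\<not> count_list (\<theta> i) j > 0"
  then have 0: "?M $$ (i, j) = 0" using ij by (auto simp: subst_matrix_def)
  have M: "?M \<in> carrier_mat 2 2" by (simp add: subst_matrix_def)
  have "(?M ^\<^sub>m n) $$ (i, j) = 0" for n
  proof (induction n)
    case 0 then show ?case using ij M by auto
  next
    case (Suc n)
    have "?M ^\<^sub>m n \<in> carrier_mat 2 2" using M by simp
    then have "(?M ^\<^sub>m Suc n) $$ (i, j) = (\<Sum>k<2. (?M ^\<^sub>m n) $$ (i, k) * ?M $$ (k, j))"
      using M ij by (auto simp: scalar_prod_def lessThan_atLeast0)
    then show ?case using Suc 0 ij by (auto simp: numeral_2_eq_2)
  qed
  moreover have "i < 2" "j < 2" using ij by auto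
  ultimately show False using prim unfolding primitive_substitution_def by (metis less_irrefl)
qed

lemma rational_of_real:
  assumes "complex_of_real r \<in> \<rat>"
  shows "r \<in> \<rat>"
proof -
  obtain a b :: int where "b > 0" "complex_of_real r = of_int a / of_int b"
    using assms by (elim Rats_cases') auto
  then have "complex_of_real r = complex_of_real (of_int a / of_int b)" by simp
  then have "r = of_int a / of_int b" by (simp only: of_real_eq_iff)
  then show ?thesis by simp
qed

text \<open>The eigenvalue is rational by assumption, and the eigenvector equation then makes the
  ratio of the lengths rational. So \<open>w\<close> is a multiple of a vector of coprime integers,
  and coprimality in turn makes the eigenvalue an integer.\<close>

lemma integral_eigenvector:
  assumes sub: "is_substitution \<theta>" and prim: "primitive_substitution \<theta>"
    and hd: "hd (\<theta> 0) = 0" "hd (\<theta> 1) = 1"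
    and rat: "rational_eigenvalues \<theta>" and pf: "pf_eigenvector \<theta> w"
  obtains c :: real and v :: "nat \<Rightarrow> nat" and L :: nat where
    "c > 0" "\<And>i. i \<in> {0, 1} \<Longrightarrow> w $ i = c * v i" "v 0 > 0" "v 1 > 0" "coprime (v 0) (v 1)"
    "L \<ge> 2" "\<And>i. i \<in> {0, 1} \<Longrightarrow> sum_list (map v (\<theta> i)) = L * v i"
    "\<And>i j. i \<in> {0, 1} \<Longrightarrow> j \<in> {0, 1} \<Longrightarrow> i \<in> set (\<theta> j)"
proof -
  let ?M = "subst_matrix \<theta>"
  define \<mu> where "\<mu> = pf_eigenvalue \<theta>"
  have w: "w \<in> carrier_vec 2" "w $ 0 > 0" "w $ 1 > 0" and ev: "map_mat real ?M *\<^sub>v w = \<mu> \<cdot>\<^sub>v w"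
    using pf by (auto simp: pf_eigenvector_def eigenvector_def subst_matrix_def \<mu>_def)
  have occ: "i \<in> set (\<theta> j)" if "i \<in> {0, 1}" "j \<in> {0, 1}" for i j
  proof (cases "i = j")
    case True
    have "\<theta> j \<noteq> []" "hd (\<theta> j) = j" using sub hd that unfolding is_substitution_def by auto
    then show ?thesis using True list.set_sel(1)[of "\<theta> j"] by simp
  next
    case False
    then have "count_list (\<theta> j) i > 0" using primitive_off_diagonal[OF prim that(2,1)] by simp
    then show ?thesis using count_notin[of i "\<theta> j"] by fastforce
  qed
  have row: "real (count_list (\<theta> i) 0) * w $ 0 + real (count_list (\<theta> i) 1) * w $ 1 = \<mu> * w $ i"
    if "i \<in> {0, 1}" for i
  proof -
    have i: "i < 2" using that by auto
    have "(map_mat real ?M *\<^sub>v w) $ i = (\<mu> \<cdot>\<^sub>v w) $ i" by (simp add: ev)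
    then show ?thesis
      using w i by (simp add: subst_matrix_def scalar_prod_def numeral_2_eq_2)
  qed
  have "\<mu> \<in> \<rat>"
  proof (rule rational_of_real)
    define A :: "complex mat" where "A = map_mat of_nat ?M"
    have A: "dim_row A = 2" "dim_col A = 2" by (simp_all add: A_def subst_matrix_def)
    have "map_vec complex_of_real w \<noteq> 0\<^sub>v 2"
    proof
      assume "map_vec complex_of_real w = 0\<^sub>v 2"
      from arg_cong[OF this, of "\<lambda>u. u $ 0"] show False using w by simp
    qed
    moreover have "A *\<^sub>v map_vec complex_of_real w = complex_of_real \<mu> \<cdot>\<^sub>v map_vec complex_of_real w"
    proof (rule eq_vecI)
      fix i assume "i < dim_vec (complex_of_real \<mu> \<cdot>\<^sub>v map_vec complex_of_real w)"
      then have i: "i < 2" using w by simp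
      then have "i \<in> {0, 1}" by auto
      from arg_cong[OF row[OF this], of complex_of_real]
      show "(A *\<^sub>v map_vec complex_of_real w) $ i = (complex_of_real \<mu> \<cdot>\<^sub>v map_vec complex_of_real w) $ i"
        using w i by (simp add: A_def subst_matrix_def scalar_prod_def numeral_2_eq_2)
    qed (use w A in simp)
    ultimately have "eigenvector (map_mat of_nat ?M) (map_vec complex_of_real w) (complex_of_real \<mu>)"
      using w A unfolding eigenvector_def A_def by simp
    then show "complex_of_real \<mu> \<in> \<rat>"
      using rat unfolding rational_eigenvalues_def eigenvalue_def by blast
  qed
  define b where "b = real (count_list (\<theta> 0) 1)"
  have b: "b > 0" using primitive_off_diagonal[OF prim, of 0 1] by (simp add: b_def)
  have "w $ 1 / w $ 0 = (\<mu> - real (count_list (\<theta> 0) 0)) / b"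
    using row[of 0] w b by (simp add: b_def field_simps)
  also have "\<dots> \<in> \<rat>" using \<open>\<mu> \<in> \<rat>\<close> by (simp add: b_def)
  finally have "w $ 1 / w $ 0 \<in> \<rat>" .
  then obtain q p :: nat where p: "p \<noteq> 0" and pq: "\<bar>w $ 1 / w $ 0\<bar> = q / p" "coprime q p"
    by (rule Rats_abs_nat_div_natE)
  define c where "c = w $ 0 / p"
  have c: "c > 0" "w $ 0 = c * p" "w $ 1 = c * q"
    using w p pq(1) by (simp_all add: c_def field_simps)
  have q: "q > 0" using c(3) w(3) by (cases "q = 0") simp_all
  have row': "real (count_list (\<theta> i) 0) * p + real (count_list (\<theta> i) 1) * q = \<mu> * (if i = 0 then p else q)"
    if "i \<in> {0, 1}" for i
  proof -
    have wi: "w $ i = c * (if i = 0 then p else q)" using that c(2,3) by auto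
    have "c * (real (count_list (\<theta> i) 0) * p + real (count_list (\<theta> i) 1) * q)
        = real (count_list (\<theta> i) 0) * w $ 0 + real (count_list (\<theta> i) 1) * w $ 1"
      unfolding c(2,3) by (simp add: algebra_simps)
    also have "\<dots> = c * (\<mu> * (if i = 0 then p else q))" unfolding row[OF that] wi by simp
    finally have "c * (real (count_list (\<theta> i) 0) * p + real (count_list (\<theta> i) 1) * q)
        = c * (\<mu> * (if i = 0 then p else q))" .
    then show ?thesis using c(1) by simp
  qed
  obtain s t :: int where st: "s * int p + t * int q = 1"
    using bezout_int[of "int p" "int q"] pq(2) by (auto simp: coprime_commute)
  \<comment> \<open>Both \<open>\<mu> * p\<close> and \<open>\<mu> * q\<close> are integers, as the
    matrix is integral; a Bezout combination isolates \<open>\<mu>\<close>.\<close>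
  have "\<mu> = \<mu> * of_int (s * int p + t * int q)" using st by simp
  also have "\<dots> = of_int s * (\<mu> * p) + of_int t * (\<mu> * q)" by (simp add: algebra_simps)
  also have "\<dots> = of_int (s * (int (count_list (\<theta> 0) 0) * p + int (count_list (\<theta> 0) 1) * q)
      + t * (int (count_list (\<theta> 1) 0) * p + int (count_list (\<theta> 1) 1) * q))"
    using row'[of 0] row'[of 1] by simp
  finally obtain l :: int where l: "\<mu> = of_int l" by blast
  \<comment> \<open>The image of 0 contains 0 and also 1, so it is longer than the tile 0 itself;
    this excludes the eigenvalue 1.\<close>
  have "\<mu> * p > p"
  proof -
    have "count_list (\<theta> 0) 0 > 0"
      using occ[of 0 0] by (simp add: count_list_0_iff neq0_conv[symmetric])
    then have "p * 1 \<le> p * count_list (\<theta> 0) 0" by (intro mult_le_mono2) simp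
    moreover have "q * count_list (\<theta> 0) 1 > 0"
      using primitive_off_diagonal[OF prim, of 0 1] q by simp
    ultimately have "p * 1 < p * count_list (\<theta> 0) 0 + q * count_list (\<theta> 0) 1" by linarith
    then have "real (p * 1) < real (p * count_list (\<theta> 0) 0 + q * count_list (\<theta> 0) 1)"
      by (simp only: of_nat_less_iff)
    then show ?thesis using row'[of 0] by (simp add: algebra_simps)
  qed
  then have "\<mu> > 1" using p by simp
  then have l2: "l \<ge> 2" using l by simp
  define L where "L = nat l"
  have L: "L \<ge> 2" "\<mu> = real L" using l2 l by (simp_all add: L_def)
  define v where "v i = (if i = 0 then p else q)" for i :: nat
  have v: "v 0 = p" "v 1 = q" by (simp_all add: v_def)
  have len: "sum_list (map v (\<theta> i)) = L * v i" if i: "i \<in> {0, 1}" for i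
  proof -
    have "set (\<theta> i) \<subseteq> {0, 1}" using sub i unfolding is_substitution_def by blast
    moreover have "real (count_list (\<theta> i) 0 * p + count_list (\<theta> i) 1 * q) = real (L * v i)"
      using row'[OF i] L(2) by (simp add: v_def)
    then have "count_list (\<theta> i) 0 * p + count_list (\<theta> i) 1 * q = L * v i"
      by (simp only: of_nat_eq_iff)
    ultimately show ?thesis by (simp only: sum_list_letters v)
  qed
  have "w $ i = c * v i" if "i \<in> {0, 1}" for i using that c v by auto
  moreover have "v 0 > 0" "v 1 > 0" "coprime (v 0) (v 1)"
    using p q pq(2) v by (simp_all add: coprime_commute)
  ultimately show ?thesis using that c(1) L(1) len occ by blast
qed

lemma strict_mono_surj_id:
  fixes g :: "nat \<Rightarrow> nat"
  assumes "strict_mono g" "surj g"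
  shows "g k = k"
proof (induction k rule: less_induct)
  case (less k)
  obtain j where j: "k = g j" using assms(2) by (rule surjE)
  have "j \<le> k" using strict_mono_imp_increasing[OF assms(1), of j] j by simp
  show ?case
  proof (cases "j = k")
    case True
    then show ?thesis using j by metis
  next
    case False
    then have "j < k" using \<open>j \<le> k\<close> by simp
    then have "g j = j" by (rule less.IH)
    then show ?thesis using j False by metis
  qed
qed

section \<open>The diagonal\<close>

locale diagonal_tiling =
  fixes w :: "real vec" and c :: real and v x y :: "nat \<Rightarrow> nat"
  assumes c: "c > 0" and v_pos: "\<And>m. v (x m) > 0" "\<And>m. v (y m) > 0"
    and w_eq: "\<And>m. w $ x m = c * v (x m)" "\<And>m. w $ y m = c * v (y m)"
begin

text \<open>The diagonal passes into a new tile where it crosses a boundary of either tiling, and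
  all boundaries are multiples of \<open>c\<close>. So the tiles on the diagonal correspond to these
  indices.\<close>

definition starts :: "nat set" where
  "starts = {n. snd (locate v x n) = 0 \<or> snd (locate v y n) = 0}"

definition tile_index :: "nat \<Rightarrow> nat \<times> nat" where
  "tile_index n = (fst (locate v x n), fst (locate v y n))"

text \<open>
  The diagonal enters the tile pair at a start \<open>n\<close> and leaves it after \<open>room\<close> unit steps.
\<close>

definition room :: "nat \<times> nat \<Rightarrow> nat \<times> nat \<Rightarrow> nat" where
  "room a b = min (v (fst a) - snd a) (v (fst b) - snd b)"

text \<open>The type of a diagonal tile is a function of the two cells where the diagonal enters it.
  So frequencies of letters become frequencies of sets of pairs.\<close>

definition letter :: "nat \<times> nat \<Rightarrow> nat \<times> nat \<Rightarrow> diagonal_letter" where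
  "letter a b = ((fst a, fst b),
     (\<lambda>z. (c * snd a + z, c * snd b + z)) ` {0<..<c * room a b})"

lemma boundary_eq:
  "boundary w x m = c * tile_start v x m" "boundary w y m = c * tile_start v y m"
  by (simp_all add: boundary_def tile_start_def w_eq sum_distrib_left)

lemma start_locate:
  assumes "n \<in> starts"
  obtains m s l t where "locate v x n = (m, s)" "locate v y n = (l, t)"
    "n = tile_start v x m + s" "n = tile_start v y l + t" "s < v (x m)" "t < v (y l)" "s = 0 \<or> t = 0"
    "cell v x n = (x m, s)" "cell v y n = (y l, t)"
proof -
  obtain m s l t where e: "locate v x n = (m, s)" "locate v y n = (l, t)"
    by (meson surj_pair)
  show ?thesis
    using that[OF e] locate_spec[OF v_pos(1) e(1)] locate_spec[OF v_pos(2) e(2)] assms e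
    by (simp add: starts_def cell_def)
qed

text \<open>At a start one of the two offsets is 0, so \<open>n\<close> is the larger of the two
  lower boundaries; \<open>room\<close> leads to the smaller of the upper ones.\<close>

lemma diagonal_tile_iff:
  assumes n: "n \<in> starts"
  shows "(\<tau>, \<tau>) \<in> tile_interior w x y (tile_index n) \<longleftrightarrow>
    c * n < \<tau> \<and> \<tau> < c * (n + room (cell v x n) (cell v y n))"
proof -
  obtain m s l t where e: "locate v x n = (m, s)" "locate v y n = (l, t)"
    "n = tile_start v x m + s" "n = tile_start v y l + t" "s < v (x m)" "t < v (y l)" "s = 0 \<or> t = 0"
    "cell v x n = (x m, s)" "cell v y n = (y l, t)"
    using start_locate[OF n] .
  have "room (cell v x n) (cell v y n) = min (v (x m) - s) (v (y l) - t)"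
    by (simp add: e(8,9) room_def)
  then have "n + room (cell v x n) (cell v y n) = min (tile_start v x (Suc m)) (tile_start v y (Suc l))"
    using e(3-6) by (auto simp: tile_start_def min_def)
  then have hi: "\<tau> < c * (n + room (cell v x n) (cell v y n)) \<longleftrightarrow>
      \<tau> < c * tile_start v x (Suc m) \<and> \<tau> < c * tile_start v y (Suc l)"
    using c by (auto simp: min_def intro: less_le_trans)
  have "tile_start v x m \<le> n" "tile_start v y l \<le> n" "n = tile_start v x m \<or> n = tile_start v y l"
    using e(3,4,7) by linarith+
  then have "c * tile_start v x m \<le> c * n" "c * tile_start v y l \<le> c * n"
      "c * n = c * tile_start v x m \<or> c * n = c * tile_start v y l"
    using c by auto
  then have lo: "c * n < \<tau> \<longleftrightarrow> c * tile_start v x m < \<tau> \<and> c * tile_start v y l < \<tau>"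
    by linarith
  show ?thesis
    unfolding lo hi by (auto simp: tile_interior_def tile_index_def e(1,2) boundary_eq)
qed

lemma room_pos: "n \<in> starts \<Longrightarrow> room (cell v x n) (cell v y n) > 0"
  by (erule start_locate) (simp add: room_def)

lemma midpoint_in_tile:
  assumes "n \<in> starts"
  obtains \<tau> where "\<tau> > 0" "(\<tau>, \<tau>) \<in> tile_interior w x y (tile_index n)"
proof -
  let ?\<tau> = "c * (n + room (cell v x n) (cell v y n) / 2)"
  have "c * n < ?\<tau>" "?\<tau> < c * (n + room (cell v x n) (cell v y n))"
    using c room_pos[OF assms] by simp_all
  moreover have "0 \<le> c * n" using c by simp
  ultimately show ?thesis
    using that[of ?\<tau>] diagonal_tile_iff[OF assms, of ?\<tau>] by linarith
qed

lemma diagonal_tiles_eq: "diagonal_tiles w x y = tile_index ` starts"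
proof (intro Set.set_eqI iffI)
  fix p assume "p \<in> tile_index ` starts"
  then obtain n where n: "n \<in> starts" "p = tile_index n" by blast
  obtain \<tau> where "\<tau> > 0" "(\<tau>, \<tau>) \<in> tile_interior w x y p"
    using midpoint_in_tile[OF n(1)] n(2) by blast
  then show "p \<in> diagonal_tiles w x y"
    unfolding diagonal_tiles_def diagonal_line_def by blast
next
  fix p assume "p \<in> diagonal_tiles w x y"
  then obtain m l \<tau> where p: "p = (m, l)" and "(\<tau>, \<tau>) \<in> tile_interior w x y (m, l)"
    unfolding diagonal_tiles_def diagonal_line_def by (cases p) auto
  then have "c * tile_start v x m < \<tau>" "c * tile_start v y l < \<tau>"
      "\<tau> < c * tile_start v x (Suc m)" "\<tau> < c * tile_start v y (Suc l)"
    by (auto simp: tile_interior_def boundary_eq)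
  then have lt: "tile_start v x m < tile_start v y (Suc l)" "tile_start v y l < tile_start v x (Suc m)"
  proof -
    have "c * tile_start v x m < c * tile_start v y (Suc l)" "c * tile_start v y l < c * tile_start v x (Suc m)"
      using \<open>c * tile_start v x m < \<tau>\<close> \<open>c * tile_start v y l < \<tau>\<close>
        \<open>\<tau> < c * tile_start v x (Suc m)\<close> \<open>\<tau> < c * tile_start v y (Suc l)\<close> by linarith+
    then show "tile_start v x m < tile_start v y (Suc l)" "tile_start v y l < tile_start v x (Suc m)"
      using c by simp_all
  qed
  \<comment> \<open>The diagonal enters the tile at the later of its left and its lower
    side.\<close>
  define n where "n = max (tile_start v x m) (tile_start v y l)"
  have "n = tile_start v x m + (n - tile_start v x m)" "n - tile_start v x m < v (x m)"
    using lt v_pos(1)[of m] v_pos(2)[of l] by (auto simp: n_def tile_start_def max_def)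
  then have 1: "locate v x n = (m, n - tile_start v x m)"
    using locate_eq[of v x "n - tile_start v x m" m, OF v_pos(1)] by simp
  have "n = tile_start v y l + (n - tile_start v y l)" "n - tile_start v y l < v (y l)"
    using lt v_pos(1)[of m] v_pos(2)[of l] by (auto simp: n_def tile_start_def max_def)
  then have 2: "locate v y n = (l, n - tile_start v y l)"
    using locate_eq[of v y "n - tile_start v y l" l, OF v_pos(2)] by simp
  have "n \<in> starts" unfolding starts_def using 1 2 by (simp add: n_def max_def)
  moreover have "tile_index n = p" using 1 2 p by (simp add: tile_index_def)
  ultimately show "p \<in> tile_index ` starts" by blast
qed

lemma room_next:
  assumes n: "n \<in> starts" and n': "n' \<in> starts" and "n < n'"
  shows "n + room (cell v x n) (cell v y n) \<le> n'"
proof (rule ccontr)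
  obtain m s l t where e: "locate v x n = (m, s)" "locate v y n = (l, t)"
    "n = tile_start v x m + s" "n = tile_start v y l + t" "s < v (x m)" "t < v (y l)" "s = 0 \<or> t = 0"
    "cell v x n = (x m, s)" "cell v y n = (y l, t)"
    using start_locate[OF n] .
  define d where "d = n' - n"
  have n'_eq: "n' = n + d" using \<open>n < n'\<close> by (simp add: d_def)
  have "room (cell v x n) (cell v y n) = min (v (x m) - s) (v (y l) - t)"
    by (simp add: e(8,9) room_def)
  moreover assume "\<not> ?thesis"
  ultimately have rm: "d < v (x m) - s" "d < v (y l) - t" using n'_eq by simp_all
  then have d: "d > 0" "s + d < v (x m)" "t + d < v (y l)"
    using \<open>n < n'\<close> n'_eq rm by linarith+
  have idx: "tile_start v x m + (s + d) = n'" "tile_start v y l + (t + d) = n'"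
    using e(3,4) n'_eq by simp_all
  have "locate v x n' = (m, s + d)" "locate v y n' = (l, t + d)"
    using locate_eq[of v x "s + d" m, OF v_pos(1) d(2)] locate_eq[of v y "t + d" l, OF v_pos(2) d(3)]
    unfolding idx by blast+
  then show False using n' d(1) by (simp add: starts_def)
qed

lemma tile_order:
  assumes "n \<in> starts" "n' \<in> starts" "n < n'"
    and "(\<sigma>, \<sigma>) \<in> tile_interior w x y (tile_index n)" "(\<tau>, \<tau>) \<in> tile_interior w x y (tile_index n')"
  shows "\<sigma> < \<tau>"
proof -
  have "\<sigma> < c * (n + room (cell v x n) (cell v y n))" "c * n' < \<tau>"
    using assms diagonal_tile_iff by blast+
  moreover have "c * (n + room (cell v x n) (cell v y n)) \<le> c * n'"
    using room_next[OF assms(1-3)] c by (intro mult_left_mono) (simp_all flip: of_nat_add)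
  ultimately show ?thesis by linarith
qed

lemma infinite_starts: "infinite starts"
proof -
  have "locate v x (tile_start v x m + 0) = (m, 0)" for m
    by (rule locate_eq[of v x 0 m, OF v_pos(1) v_pos(1)])
  then have "range (tile_start v x) \<subseteq> starts" by (auto simp: starts_def)
  moreover have "strict_mono (tile_start v x)"
    using v_pos by (simp add: strict_mono_Suc_iff tile_start_def)
  then have "infinite (range (tile_start v x))"
    using finite_imageD infinite_UNIV_nat strict_mono_imp_inj_on by blast
  ultimately show ?thesis by (rule infinite_super)
qed

text \<open>The enumeration of \<open>starts\<close> has the defining property. Any other sequence
  with it visits the same tiles through a reindexing \<open>g\<close>, which is strictly increasing
  and onto, hence the identity.\<close>

lemma diagonal_enum_eq: "diagonal_enum w x y k = tile_index (enumerate starts k)"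
proof -
  let ?e = "enumerate starts"
  have inS: "?e k \<in> starts" for k by (rule enumerate_in_set[OF infinite_starts])
  have ran: "range ?e = starts" by (rule range_enumerate[OF infinite_starts])
  define ordered where "ordered d \<longleftrightarrow> (\<forall>k l s t. k < l \<and> (s, s) \<in> tile_interior w x y (d k) \<and>
      (t, t) \<in> tile_interior w x y (d l) \<longrightarrow> s < t)" for d :: "nat \<Rightarrow> nat \<times> nat"
  have "diagonal_enum w x y = (\<lambda>k. tile_index (?e k))"
    unfolding diagonal_enum_def ordered_def[symmetric]
  proof (rule the_equality)
    have "range (\<lambda>k. tile_index (?e k)) = diagonal_tiles w x y"
      unfolding diagonal_tiles_eq by (metis image_image ran)
    moreover have "ordered (\<lambda>k. tile_index (?e k))"
      unfolding ordered_def using tile_order[OF inS inS] enumerate_mono[OF _ infinite_starts] by blast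
    ultimately show "range (\<lambda>k. tile_index (?e k)) = diagonal_tiles w x y \<and> ordered (\<lambda>k. tile_index (?e k))"
      by blast
  next
    fix d assume d: "range d = diagonal_tiles w x y \<and> ordered d"
    have "\<exists>j. d k = tile_index (?e j)" for k
    proof -
      have "d k \<in> tile_index ` range ?e" unfolding ran using d diagonal_tiles_eq by blast
      then show ?thesis by blast
    qed
    then obtain g where g: "\<And>k. d k = tile_index (?e (g k))" by metis
    have mono: "g k < g l" if "k < l" for k l
    proof (rule ccontr)
      assume "\<not> g k < g l"
      obtain \<sigma> \<tau> where \<sigma>: "(\<sigma>, \<sigma>) \<in> tile_interior w x y (tile_index (?e (g k)))"
        and \<tau>: "(\<tau>, \<tau>) \<in> tile_interior w x y (tile_index (?e (g l)))"
        using midpoint_in_tile[OF inS] by metis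
      have lt: "a < b" if "(a, a) \<in> tile_interior w x y (tile_index (?e (g k)))"
          "(b, b) \<in> tile_interior w x y (tile_index (?e (g l)))" for a b
        using d that \<open>k < l\<close> unfolding ordered_def g by blast
      show False
      proof (cases "g k = g l")
        case True
        then show False using lt[of \<sigma> \<sigma>] \<sigma> by simp
      next
        case False
        then have "?e (g l) < ?e (g k)"
          using \<open>\<not> g k < g l\<close> enumerate_mono[OF _ infinite_starts] by simp
        then have "\<tau> < \<sigma>" using tile_order[OF inS inS] \<sigma> \<tau> by blast
        then show False using lt[OF \<sigma> \<tau>] by simp
      qed
    qed
    have inj: "j = j'" if "tile_index (?e j) = tile_index (?e j')" for j j'
    proof (rule ccontr)
      assume "j \<noteq> j'"
      then have ne: "?e j \<noteq> ?e j'" using enumerate_mono[OF _ infinite_starts] by (metis linorder_neqE_nat less_irrefl)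
      obtain \<sigma> where "(\<sigma>, \<sigma>) \<in> tile_interior w x y (tile_index (?e j))"
        using midpoint_in_tile[OF inS] by metis
      then show False
        using tile_order[OF inS inS, of j j' \<sigma> \<sigma>] tile_order[OF inS inS, of j' j \<sigma> \<sigma>] ne that
        by (metis less_irrefl linorder_neqE_nat)
    qed
    have "surj g"
      unfolding surj_def
    proof (rule allI)
      fix j
      have "tile_index (?e j) \<in> range d" using d inS by (auto simp: diagonal_tiles_eq)
      then show "\<exists>k. j = g k" using g inj by (metis imageE)
    qed
    moreover have "strict_mono g" using mono by (rule strict_monoI)
    ultimately have "g k = k" for k using strict_mono_surj_id by blast
    then show "d = (\<lambda>k. tile_index (?e k))" by (intro ext) (simp only: g)
  qed
  then show ?thesis by simp
qed

lemma tile_type_start: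
  assumes n: "n \<in> starts"
  shows "tile_type w x y (tile_index n) = letter (cell v x n) (cell v y n)"
proof -
  obtain m s l t where e: "locate v x n = (m, s)" "locate v y n = (l, t)"
    "n = tile_start v x m + s" "n = tile_start v y l + t" "s < v (x m)" "t < v (y l)" "s = 0 \<or> t = 0"
    "cell v x n = (x m, s)" "cell v y n = (y l, t)"
    using start_locate[OF n] .
  define r where "r = room (cell v x n) (cell v y n)"
  have "0 \<le> c * n" using c by simp
  then have trace: "tile_interior w x y (tile_index n) \<inter> diagonal_line
      = (\<lambda>z. (c * n + z, c * n + z)) ` {0<..<c * r}"
  proof (intro Set.set_eqI iffI)
    fix p assume "p \<in> tile_interior w x y (tile_index n) \<inter> diagonal_line"
    then obtain \<tau> where "p = (\<tau>, \<tau>)" "c * n < \<tau>" "\<tau> < c * (n + r)"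
      using diagonal_tile_iff[OF n, folded r_def] by (auto simp: diagonal_line_def)
    then show "p \<in> (\<lambda>z. (c * n + z, c * n + z)) ` {0<..<c * r}"
      by (intro image_eqI[of _ _ "\<tau> - c * n"]) (auto simp: algebra_simps)
  next
    fix p assume "p \<in> (\<lambda>z. (c * n + z, c * n + z)) ` {0<..<c * r}"
    then obtain z where "p = (c * n + z, c * n + z)" "0 < z" "z < c * r" by auto
    then show "p \<in> tile_interior w x y (tile_index n) \<inter> diagonal_line"
      using diagonal_tile_iff[OF n, folded r_def, of "c * n + z"] \<open>0 \<le> c * n\<close>
      by (auto simp: diagonal_line_def algebra_simps)
  qed
  have "c * n - c * tile_start v x m = c * s"
    using arg_cong[OF e(3), of real] by (simp add: algebra_simps)
  moreover have "c * n - c * tile_start v y l = c * t"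
    using arg_cong[OF e(4), of real] by (simp add: algebra_simps)
  ultimately have "c * n + z - c * tile_start v x m = c * s + z" "c * n + z - c * tile_start v y l = c * t + z" for z
    by linarith+
  note shift = this
  have "(\<lambda>(a, b). (a - boundary w x m, b - boundary w y l)) `
      (tile_interior w x y (m, l) \<inter> diagonal_line)
      = (\<lambda>z. (c * n + z - c * tile_start v x m, c * n + z - c * tile_start v y l)) ` {0<..<c * r}"
    using trace by (simp add: tile_index_def e(1,2) image_image boundary_eq)
  also have "\<dots> = (\<lambda>z. (c * s + z, c * t + z)) ` {0<..<c * r}" by (simp only: shift)
  finally have "(\<lambda>(a, b). (a - boundary w x m, b - boundary w y l)) `
      (tile_interior w x y (m, l) \<inter> diagonal_line) = (\<lambda>z. (c * s + z, c * t + z)) ` {0<..<c * r}" .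
  then show ?thesis
    by (simp add: tile_type_def tile_index_def letter_def array_product_def e(1,2,8,9) r_def)
qed

lemma diagonal_word_eq:
  "diagonal_word w x y k =
    letter (cell v x (enumerate starts k)) (cell v y (enumerate starts k))"
  unfolding diagonal_word_def diagonal_enum_eq
  by (rule tile_type_start) (rule enumerate_in_set[OF infinite_starts])

end

section \<open>From averages over cells to averages over diagonal tiles\<close>

lemma card_below_enumerate:
  fixes S :: "nat set"
  assumes "infinite S"
  shows "card {k. k < K \<and> P (enumerate S k)} = card {n. n < enumerate S K \<and> n \<in> S \<and> P n}"
proof -
  have "{n. n < enumerate S K \<and> n \<in> S \<and> P n} = enumerate S ` {k. k < K \<and> P (enumerate S k)}"
    using assms enumerate_Ex[OF assms] enumerate_in_set[OF assms] by (fastforce simp: image_iff)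
  moreover have "inj_on (enumerate S) {k. k < K \<and> P (enumerate S k)}"
    using inj_enumerate[OF assms] by (rule inj_on_subset) simp
  ultimately show ?thesis by (simp add: card_image)
qed

text \<open>Below \<open>enumerate S K\<close> there are exactly \<open>K\<close> elements of
  \<open>S\<close>. So the wanted ratio is a quotient of two averages along the subsequence
  \<open>enumerate S\<close>, and bounded gaps keep the limit of the denominator positive.\<close>

lemma enumerate_frequency:
  fixes S :: "nat set" and P :: "nat \<Rightarrow> bool"
  assumes S: "infinite S" "0 \<in> S" and gap: "\<And>n. n \<in> S \<Longrightarrow> \<exists>n'\<in>S. n < n' \<and> n' \<le> n + W"
    and cS: "convergent (\<lambda>N. (\<Sum>n<N. of_bool (n \<in> S)) / real N)"
    and cP: "convergent (\<lambda>N. (\<Sum>n<N. of_bool (n \<in> S \<and> P n)) / real N)"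
  shows "convergent (\<lambda>K. real (card {k. k < K \<and> P (enumerate S k)}) / real K)"
proof -
  let ?e = "enumerate S"
  have card_eq: "(\<Sum>n<N. of_bool (Q n)) = real (card {n. n < N \<and> Q n})" for N and Q :: "nat \<Rightarrow> bool"
    by (simp add: Collect_conj_eq lessThan_def Int_commute)
  have sub: "strict_mono ?e" using strict_mono_enumerate[OF S(1)] .
  obtain \<alpha> \<beta> where "(\<lambda>N. (\<Sum>n<N. of_bool (n \<in> S)) / real N) \<longlonglongrightarrow> \<alpha>"
    and "(\<lambda>N. (\<Sum>n<N. of_bool (n \<in> S \<and> P n)) / real N) \<longlonglongrightarrow> \<beta>"
    using cS cP by (auto simp: convergent_def)
  from this[THEN LIMSEQ_subseq_LIMSEQ, OF sub]
  have lim: "(\<lambda>K. real K / real (?e K)) \<longlonglongrightarrow> \<alpha>"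
    "(\<lambda>K. real (card {k. k < K \<and> P (?e k)}) / real (?e K)) \<longlonglongrightarrow> \<beta>"
    using card_below_enumerate[OF S(1), of _ "\<lambda>_. True"] card_below_enumerate[OF S(1), of _ P]
    by (simp_all add: card_eq o_def)
  have up: "?e K \<le> W * K" for K
  proof (induction K)
    case 0
    show ?case using S(2) by (simp add: enumerate_0 Least_eq_0)
  next
    case (Suc K)
    obtain n' where n': "n' \<in> S" "?e K < n'" "n' \<le> ?e K + W"
      using gap[OF enumerate_in_set[OF S(1)]] by blast
    have "?e (Suc K) \<le> n'"
      unfolding enumerate_Suc''[OF S(1)] by (rule Least_le) (use n' in simp)
    then show ?case using n' Suc by simp
  qed
  have pos: "?e K > 0" if "K > 0" for K
    using enumerate_mono[OF that S(1)] by simp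
  have "?e 1 \<le> W" using up[of 1] by simp
  then have W: "W > 0" using pos[of 1] by simp
  have "1 / real W \<le> real K / real (?e K)" if "K \<ge> 1" for K
  proof -
    have "real (?e K) \<le> real (W * K)" using up[of K] by (simp only: of_nat_le_iff)
    then show ?thesis using that pos[of K] W by (simp add: field_simps)
  qed
  then have "1 / real W \<le> \<alpha>" by (intro LIMSEQ_le_const[OF lim(1)]) blast
  then have "\<alpha> \<noteq> 0" using W by auto
  with lim have "(\<lambda>K. (real (card {k. k < K \<and> P (?e k)}) / real (?e K)) / (real K / real (?e K))) \<longlonglongrightarrow> \<beta> / \<alpha>"
    by (intro tendsto_divide)
  moreover have "(real (card {k. k < K \<and> P (?e k)}) / real (?e K)) / (real K / real (?e K))
      = real (card {k. k < K \<and> P (?e k)}) / real K" for K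
    using pos[of K] by (cases "K = 0") auto
  ultimately have "(\<lambda>K. real (card {k. k < K \<and> P (?e k)}) / real K) \<longlonglongrightarrow> \<beta> / \<alpha>"
    by (simp only:)
  then show ?thesis by (rule convergentI)
qed

lemma tile_start_add:
  "tile_start v x (m + l) = tile_start v x m + (\<Sum>s<l. v (x (m + s)))"
  by (induction l) (simp_all add: tile_start_def)

text \<open>When the image of a tile \<open>i\<close> has \<open>L * v i\<close> cells, they are
  dealt out \<open>L\<close> at a time to the cells \<open>(i, s)\<close>, from position
  \<open>L * s\<close> on. This turns \<open>\<theta>\<close> into a substitution of constant
  length.\<close>

definition column :: "(nat \<Rightarrow> nat) \<Rightarrow> (nat \<Rightarrow> nat list) \<Rightarrow> nat \<Rightarrow> nat \<Rightarrow> nat \<times> nat \<Rightarrow> nat \<times> nat" where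
  "column v \<theta> L r a = cell_at v (\<theta> (fst a)) (L * snd a + r)"

lemma (in cell_substitution) fixed_cells_cell:
  assumes x: "\<And>m. x m \<in> {0, 1}" and \<sigma>: "\<sigma> = column w \<theta> L"
    and len: "\<And>i. i \<in> {0, 1} \<Longrightarrow> sum_list (map w (\<theta> i)) = L * w i"
    and super_word: "\<And>k s. s < length (\<theta> (x k)) \<Longrightarrow> x ((\<Sum>i<k. length (\<theta> (x i))) + s) = \<theta> (x k) ! s"
  shows "fixed_cells (cell w x)"
proof -
  have pos: "w (x m) > 0" for m using x[of m] w_pos by auto
  let ?p = "\<lambda>k. \<Sum>i<k. length (\<theta> (x i))"
  \<comment> \<open>The image of the tile \<open>k\<close> starts at \<open>L\<close> times its own
    start: inflation multiplies every length by \<open>L\<close>.\<close>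
  have super: "tile_start w x (?p k) = L * tile_start w x k" for k
  proof (induction k)
    case (Suc k)
    have "tile_start w x (?p (Suc k)) = tile_start w x (?p k) + (\<Sum>s<length (\<theta> (x k)). w (x (?p k + s)))"
      by (simp add: tile_start_add)
    also have "(\<Sum>s<length (\<theta> (x k)). w (x (?p k + s))) = (\<Sum>s<length (\<theta> (x k)). w (\<theta> (x k) ! s))"
      by (intro sum.cong) (simp_all add: super_word)
    also have "\<dots> = L * w (x k)"
      using len[OF x[of k]] by (simp add: sum_list_sum_nth atLeast0LessThan)
    finally show ?case using Suc by (simp add: tile_start_def algebra_simps)
  qed (simp add: tile_start_def)
  have inC: "cell w x n \<in> cells" for n
    using locate_spec(2)[of w x n, OF pos] x by (cases "locate w x n") (auto simp: cells_def cell_def)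
  have sub: "cell w x (L * n + r) = \<sigma> r (cell w x n)" if r: "r < L" for n r
  proof -
    obtain m s where e: "locate w x n = (m, s)" by (cases "locate w x n")
    note sp = locate_spec[OF pos e]
    have "L * s + r < L * Suc s" using r by simp
    also have "\<dots> \<le> L * w (x m)" using sp(2) by (intro mult_le_mono2) simp
    finally have "L * s + r < sum_list (map w (\<theta> (x m)))" by (simp only: len[OF x])
    then have "cell w x (tile_start w x (?p m) + (L * s + r)) = cell_at w (\<theta> (x m)) (L * s + r)"
      by (intro cell_at_word pos super_word)
    moreover have "tile_start w x (?p m) + (L * s + r) = L * n + r"
      using sp(1) by (simp add: super algebra_simps)
    ultimately show ?thesis by (simp add: \<sigma> column_def cell_def e)
  qed
  have step: "cell w x (Suc n) = (if Suc (snd (cell w x n)) < w (fst (cell w x n))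
      then (fst (cell w x n), Suc (snd (cell w x n))) else (fst (cell w x (Suc n)), 0))" for n
    by (cases "locate w x n") (simp add: cell_def)
  have "snd (cell w x 0) = 0" by (simp add: cell_def)
  then show ?thesis unfolding fixed_cells_def using inC sub step by blast
qed

theorem proposition1:
  fixes \<theta> :: "nat \<Rightarrow> nat list" and w :: "real vec" and x y :: "nat \<Rightarrow> nat"
    and a :: diagonal_letter
  assumes "is_substitution \<theta>" and "primitive_substitution \<theta>"
    and "hd (\<theta> 0) = 0" and "hd (\<theta> 1) = 1"
    and "rational_eigenvalues \<theta>"
    and "pf_eigenvector \<theta> w"
    and "x \<in> {limit_word \<theta> 0, limit_word \<theta> 1}"
    and "y \<in> {limit_word \<theta> 0, limit_word \<theta> 1}"
  shows "frequency_exists (diagonal_word w x y) a"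
proof -
  obtain c v L where c: "c > 0" and wv: "\<And>i. i \<in> {0, 1} \<Longrightarrow> w $ i = c * real (v i)"
    and v: "v 0 > 0" "v 1 > 0" "coprime (v 0) (v 1)" and L: "L \<ge> (2::nat)"
    and len: "\<And>i. i \<in> {0, 1} \<Longrightarrow> sum_list (map v (\<theta> i)) = L * v i"
    and occ: "\<And>i j. i \<in> {0, 1} \<Longrightarrow> j \<in> {0, 1} \<Longrightarrow> i \<in> set (\<theta> j)"
    using integral_eigenvector[OF assms(1-6)] by metis
  have v_pos: "v i > 0" if "i \<in> {0, 1}" for i using that v by auto
  have hd: "hd (\<theta> i) = i" if "i \<in> {0, 1}" for i using that assms(3,4) by auto
  interpret cell_substitution v L "column v \<theta> L"
  proof
    fix i :: nat assume i: "i \<in> {0, 1}"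
    then have "\<theta> i \<noteq> []" using assms(1) unfolding is_substitution_def by blast
    then show "column v \<theta> L 0 (i, 0) = (i, 0)"
      using hd[OF i] v_pos[OF i] by (cases "\<theta> i") (auto simp: column_def)
  next
    fix i j :: nat assume i: "i \<in> {0, 1}" and j: "j \<in> {0, 1}"
    \<comment> \<open>Position \<open>t\<close> in the image of the tile \<open>j\<close> is
      position \<open>t mod L\<close> in the image of the cell \<open>(j, t div L)\<close>.\<close>
    obtain t where t: "t < L * v j" "cell_at v (\<theta> j) t = (i, 0)"
      using cell_at_occurs[OF occ[OF i j], of v] v_pos[OF i] len[OF j] by auto
    have "t div L < v j" using t(1) by (simp add: less_mult_imp_div_less mult.commute)
    moreover have "t mod L < L" using L by simp
    moreover have "column v \<theta> L (t mod L) (j, t div L) = (i, 0)"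
      using t(2) by (simp add: column_def)
    ultimately show "\<exists>s<v j. \<exists>r<L. column v \<theta> L r (j, s) = (i, 0)" by blast
  qed (use v L in auto)
  have word: "(\<forall>m. z m \<in> {0, 1}) \<and> fixed_cells (cell v z)"
    if z: "z \<in> {limit_word \<theta> 0, limit_word \<theta> 1}" for z
  proof -
    obtain b where b: "b \<in> {0, 1}" "z = limit_word \<theta> b" using z by auto
    have letters: "z m \<in> {0, 1}" for m
      unfolding b(2) by (rule limit_word_letters[OF assms(1,2) b(1) hd[OF b(1)]])
    moreover have "fixed_cells (cell v z)"
      using limit_word_fixed[OF assms(1,2) b(1) hd[OF b(1)]] letters len
      by (intro fixed_cells_cell[of z \<theta>]) (simp_all add: b(2))
    ultimately show ?thesis by blast
  qed
  have xl: "x m \<in> {0, 1}" and yl: "y m \<in> {0, 1}" for m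
    using word[OF assms(7)] word[OF assms(8)] by blast+
  have X: "fixed_cells (cell v x)" and Y: "fixed_cells (cell v y)"
    using word[OF assms(7)] word[OF assms(8)] by blast+
  interpret diagonal_tiling w c v x y
    by standard (use c v_pos wv xl yl in auto)
  let ?P = "\<lambda>n. letter (cell v x n) (cell v y n) = a"
  have starts_iff: "n \<in> starts \<longleftrightarrow> snd (cell v x n) = 0 \<or> snd (cell v y n) = 0" for n
    by (simp add: starts_def cell_def)
  have "convergent (\<lambda>K. real (card {k. k < K \<and> ?P (enumerate starts k)}) / real K)"
  proof (rule enumerate_frequency[OF infinite_starts, where W = "v 0 + v 1"])
    show "0 \<in> starts" by (simp add: starts_def)
    fix n assume "n \<in> starts"
    obtain i s where e: "cell v x n = (i, s)" by (cases "cell v x n")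
    have i: "i \<in> {0, 1}" "s < v i"
      using fixed_cellsD(1)[OF X, of n] by (auto simp: e cells_def)
    \<comment> \<open>The next tile start of the first tiling already bounds the gap.\<close>
    have "snd (cell v x (n + (v i - s))) = 0" by (rule next_start[OF X e])
    then show "\<exists>n'\<in>starts. n < n' \<and> n' \<le> n + (v 0 + v 1)"
      using i by (intro bexI[of _ "n + (v i - s)"]) (auto simp: starts_iff)
  next
    show "convergent (\<lambda>N. (\<Sum>n<N. of_bool (n \<in> starts)) / real N)"
      unfolding starts_iff by (rule pair_frequency[OF X Y])
    show "convergent (\<lambda>N. (\<Sum>n<N. of_bool (n \<in> starts \<and> ?P n)) / real N)"
      unfolding starts_iff
      by (rule pair_frequency[OF X Y, of "\<lambda>p q. (snd p = 0 \<or> snd q = 0) \<and> letter p q = a"])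
  qed
  then show ?thesis unfolding frequency_exists_def diagonal_word_eq .
qed

end
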